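(* Let $\mathcal D$ be a triangulated category, $\Gamma$ a free abelian group of finite rank and $\operatorname{cl}:K(\mathcal D)\to\Gamma$ a linear map. Let $(\sigma_t=(Z_t,\mathcal P_t))_{t\in[0,1]}$ be a continuous family of stability conditions on $\mathcal D$ (with respect to $\operatorname{cl}$) such that the map $[0,1]\to\operatorname{Hom}(\Gamma,\mathbb C)$, $t\mapsto Z_t$, is differentiable, with derivative $Z'_t$, and $$\operatorname{Im}\bigl(Z'_t(E)\cdot\overline{Z_t(E)}\bigr)\ge0$$ for all $t\in[0,1]$ and all $\sigma_t$-stable objects $E\in\mathcal D$. Then, for any object $0\ne E\in\mathcal D$, the functions $t\mapsto\varphi^-_t(E)$ and $t\mapsto\varphi^+_t(E)$ on $[0,1]$ are weakly increasing.
   Context: $K(\mathcal D)$ is the Grothendieck group of $\mathcal D$, $\Gamma_{\mathbb R}=\Gamma\otimes_{\mathbb Z}\mathbb R$ is equipped with a norm $\|\cdot\|$. For a linear map $Z:\Gamma\to\mathbb C$ one writes $Z(E)=Z(\operatorname{cl}E)$. A slicing $\mathcal P=(\mathcal P_\varphi)_{\varphi\in\mathbb R}$ of $\mathcal D$ is a collection of full subcategories such that (i) $\mathcal P_{\varphi+1}=\mathcal P_\varphi[1]$; (ii) $\operatorname{Hom}(\mathcal P_\varphi,\mathcal P_{\varphi'})=0$ for $\varphi>\varphi'$; (iii) every $0\ne E\in\mathcal D$ has a (Harder–Narasimhan) filtration $0=E_0\to E_1\to\dots\to E_n=E$ with $\operatorname{cone}(E_{k-1}\to E_k)\in\mathcal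 P_{\varphi_k}$ (nonzero) and $\varphi_1>\dots>\varphi_n$. One puts $\varphi^+_{\mathcal P}(E)=\varphi_1$, $\varphi^-_{\mathcal P}(E)=\varphi_n$. A stability condition on $\mathcal D$ (with respect to $\operatorname{cl}$) is a pair $\sigma=(Z,\mathcal P)$ where $Z:\Gamma\to\mathbb C$ is linear and $\mathcal P$ is a slicing such that $Z(E)\in\mathbb R_{>0}e^{i\pi\varphi}$ for all $0\ne E\in\mathcal P_\varphi$, and such that there exists $\varepsilon>0$ with $|Z(E)|\ge\varepsilon\|\operatorname{cl}E\|$ for all $\sigma$-semistable $E$. Nonzero objects of $\mathcal P_\varphi$ are called $\sigma$-semistable of phase $\varphi$; simple objects of the abelian category $\mathcal P_\varphi$ are called $\sigma$-stable of phase $\varphi$. The distance between slicings is $d(\mathcal P,\mathcal Q)=\sup_{0\ne E\in\mathcal D}\{|\varphi^+_{\mathcal P}(E)-\varphi^+_{\mathcal Q}(E)|,\,|\varphi^-_{\mathcal P}(E)-\varphi^-_{\mathcal Q}(E)|\}$. A family of stability conditions $(\sigma_x=(Z_x,\mathcal P_x))_{x\in M}$ over a topological space $M$ is continuous if $x\mapsto Z_x\in\operatorname{Hom}(\Gamma,\mathbb C)$ is continuous and for any $x\in M$ and $\varepsilon>0$ there is a neighborhood $U$ of $x$ with $d(\mathcal P_x,\mathcal P_y)<\varepsilon$ for all $y\in U$. One writes $\varphi_t^\pm(E)=\varphi^\pm_{\mathcal P_t}(E)$. *)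

theory Defs
  imports "HOL-Analysis.Analysis" "HOL-Algebra.Free_Abelian_Groups"
begin

section \<open>Triangulated categories\<close>

text \<open>
  Arrows carry their source and target, so distinct hom-sets are disjoint.
  Composition is written in the usual order: \<open>cmp D g f\<close> is "g after f".
  A triangle is the triple of its three arrows; its vertices are determined by them.
\<close>

record ('o, 'm) tri_data =
  Ob :: "'o set"
  Mor :: "'m set"
  src :: "'m \<Rightarrow> 'o"
  tgt :: "'m \<Rightarrow> 'o"
  idn :: "'o \<Rightarrow> 'm"
  cmp :: "'m \<Rightarrow> 'm \<Rightarrow> 'm"
  addm :: "'m \<Rightarrow> 'm \<Rightarrow> 'm"
  zerom :: "'o \<Rightarrow> 'o \<Rightarrow> 'm"
  shO :: "'o \<Rightarrow> 'o"
  shM :: "'m \<Rightarrow> 'm"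
  dist_tri :: "('m \<times> 'm \<times> 'm) set"

definition Hom :: "('o, 'm, 'z) tri_data_scheme \<Rightarrow> 'o \<Rightarrow> 'o \<Rightarrow> 'm set" where
  "Hom D X Y = {f \<in> Mor D. src D f = X \<and> tgt D f = Y}"

definition hom_group :: "('o, 'm, 'z) tri_data_scheme \<Rightarrow> 'o \<Rightarrow> 'o \<Rightarrow> 'm monoid" where
  "hom_group D X Y = \<lparr>carrier = Hom D X Y, monoid.mult = addm D, one = zerom D X Y\<rparr>"

definition negm :: "('o, 'm, 'z) tri_data_scheme \<Rightarrow> 'm \<Rightarrow> 'm" where
  "negm D f = inv\<^bsub>hom_group D (src D f) (tgt D f)\<^esub> f"

definition iso_mor :: "('o, 'm, 'z) tri_data_scheme \<Rightarrow> 'o \<Rightarrow> 'o \<Rightarrow> 'm \<Rightarrow> bool" where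
  "iso_mor D X Y f \<longleftrightarrow> f \<in> Hom D X Y \<and>
     (\<exists>g \<in> Hom D Y X. cmp D g f = idn D X \<and> cmp D f g = idn D Y)"

definition isomorphic :: "('o, 'm, 'z) tri_data_scheme \<Rightarrow> 'o \<Rightarrow> 'o \<Rightarrow> bool" where
  "isomorphic D X Y \<longleftrightarrow> (\<exists>f. iso_mor D X Y f)"

definition zero_ob :: "('o, 'm, 'z) tri_data_scheme \<Rightarrow> 'o \<Rightarrow> bool" where
  "zero_ob D N \<longleftrightarrow> N \<in> Ob D \<and>
     (\<forall>X \<in> Ob D. (\<exists>!f. f \<in> Hom D X N) \<and> (\<exists>!f. f \<in> Hom D N X))"

definition nonzero_obs :: "('o, 'm, 'z) tri_data_scheme \<Rightarrow> 'o set" where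
  "nonzero_obs D = {E \<in> Ob D. \<not> zero_ob D E}"

locale category =
  fixes D :: "('o, 'm, 'z) tri_data_scheme"
  assumes src_Ob: "f \<in> Mor D \<Longrightarrow> src D f \<in> Ob D"
    and tgt_Ob: "f \<in> Mor D \<Longrightarrow> tgt D f \<in> Ob D"
    and idn_Hom: "X \<in> Ob D \<Longrightarrow> idn D X \<in> Hom D X X"
    and cmp_Hom: "\<lbrakk>f \<in> Hom D X Y; g \<in> Hom D Y Z\<rbrakk> \<Longrightarrow> cmp D g f \<in> Hom D X Z"
    and cmp_idn_right: "f \<in> Hom D X Y \<Longrightarrow> cmp D f (idn D X) = f"
    and cmp_idn_left: "f \<in> Hom D X Y \<Longrightarrow> cmp D (idn D Y) f = f"
    and cmp_assoc: "\<lbrakk>f \<in> Hom D W X; g \<in> Hom D X Y; h \<in> Hom D Y Z\<rbrakk> \<Longrightarrow>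
          cmp D h (cmp D g f) = cmp D (cmp D h g) f"

locale additive_category = category D
  for D :: "('o, 'm, 'z) tri_data_scheme" +
  assumes hom_comm_group: "\<lbrakk>X \<in> Ob D; Y \<in> Ob D\<rbrakk> \<Longrightarrow> comm_group (hom_group D X Y)"
    and cmp_add_right: "\<lbrakk>f \<in> Hom D X Y; f' \<in> Hom D X Y; g \<in> Hom D Y Z\<rbrakk> \<Longrightarrow>
          cmp D g (addm D f f') = addm D (cmp D g f) (cmp D g f')"
    and cmp_add_left: "\<lbrakk>f \<in> Hom D X Y; g \<in> Hom D Y Z; g' \<in> Hom D Y Z\<rbrakk> \<Longrightarrow>
          cmp D (addm D g g') f = addm D (cmp D g f) (cmp D g' f)"
    and ex_zero_ob: "\<exists>N. zero_ob D N"
    and ex_biproduct: "\<lbrakk>X \<in> Ob D; Y \<in> Ob D\<rbrakk> \<Longrightarrow>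
          \<exists>S \<in> Ob D. \<exists>i \<in> Hom D X S. \<exists>j \<in> Hom D Y S. \<exists>p \<in> Hom D S X. \<exists>q \<in> Hom D S Y.
            cmp D p i = idn D X \<and> cmp D q j = idn D Y \<and>
            cmp D q i = zerom D X Y \<and> cmp D p j = zerom D Y X \<and>
            addm D (cmp D i p) (cmp D j q) = idn D S"

text \<open>
  The shift is an additive autoequivalence (not necessarily an automorphism). This is
  why the rotation axiom is stated as an equivalence.
\<close>

locale triangulated_category = additive_category D
  for D :: "('o, 'm, 'z) tri_data_scheme" +
  assumes shO_Ob: "X \<in> Ob D \<Longrightarrow> shO D X \<in> Ob D"
    and shM_idn: "X \<in> Ob D \<Longrightarrow> shM D (idn D X) = idn D (shO D X)"
    and shM_cmp: "\<lbrakk>f \<in> Hom D X Y; g \<in> Hom D Y Z\<rbrakk> \<Longrightarrow>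
          shM D (cmp D g f) = cmp D (shM D g) (shM D f)"
    and shM_add: "\<lbrakk>f \<in> Hom D X Y; g \<in> Hom D X Y\<rbrakk> \<Longrightarrow>
          shM D (addm D f g) = addm D (shM D f) (shM D g)"
    and shM_fully_faithful: "\<lbrakk>X \<in> Ob D; Y \<in> Ob D\<rbrakk> \<Longrightarrow>
          bij_betw (shM D) (Hom D X Y) (Hom D (shO D X) (shO D Y))"
    and sh_ess_surj: "Y \<in> Ob D \<Longrightarrow> \<exists>X \<in> Ob D. isomorphic D Y (shO D X)"
    and dist_tri_Hom: "(f, g, h) \<in> dist_tri D \<Longrightarrow>
          \<exists>X Y Z. f \<in> Hom D X Y \<and> g \<in> Hom D Y Z \<and> h \<in> Hom D Z (shO D X)"
    and TR1_idn: "\<lbrakk>X \<in> Ob D; zero_ob D N\<rbrakk> \<Longrightarrow>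
          (idn D X, zerom D X N, zerom D N (shO D X)) \<in> dist_tri D"
    and TR1_iso: "\<lbrakk>(f, g, h) \<in> dist_tri D;
          f \<in> Hom D X Y; g \<in> Hom D Y Z; h \<in> Hom D Z (shO D X);
          f' \<in> Hom D X' Y'; g' \<in> Hom D Y' Z'; h' \<in> Hom D Z' (shO D X');
          iso_mor D X X' a; iso_mor D Y Y' b; iso_mor D Z Z' c;
          cmp D b f = cmp D f' a; cmp D c g = cmp D g' b;
          cmp D (shM D a) h = cmp D h' c\<rbrakk> \<Longrightarrow> (f', g', h') \<in> dist_tri D"
    and TR1_cone: "f \<in> Mor D \<Longrightarrow> \<exists>g h. (f, g, h) \<in> dist_tri D"
    and TR2: "\<lbrakk>f \<in> Hom D X Y; g \<in> Hom D Y Z; h \<in> Hom D Z (shO D X)\<rbrakk> \<Longrightarrow>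
          (f, g, h) \<in> dist_tri D \<longleftrightarrow> (g, h, negm D (shM D f)) \<in> dist_tri D"
    and TR3: "\<lbrakk>(f, g, h) \<in> dist_tri D; (f', g', h') \<in> dist_tri D;
          f \<in> Hom D X Y; g \<in> Hom D Y Z; f' \<in> Hom D X' Y'; g' \<in> Hom D Y' Z';
          a \<in> Hom D X X'; b \<in> Hom D Y Y'; cmp D b f = cmp D f' a\<rbrakk> \<Longrightarrow>
          \<exists>c \<in> Hom D Z Z'. cmp D c g = cmp D g' b \<and> cmp D (shM D a) h = cmp D h' c"
    and TR4: "\<lbrakk>f \<in> Hom D X Y; g \<in> Hom D Y Z;
          (f, f', f'') \<in> dist_tri D; f' \<in> Hom D Y C; f'' \<in> Hom D C (shO D X);
          (g, g', g'') \<in> dist_tri D; g' \<in> Hom D Z A; g'' \<in> Hom D A (shO D Y);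
          (cmp D g f, h', h'') \<in> dist_tri D; h' \<in> Hom D Z B; h'' \<in> Hom D B (shO D X)\<rbrakk> \<Longrightarrow>
          \<exists>u \<in> Hom D C B. \<exists>v \<in> Hom D B A.
            (u, v, cmp D (shM D f') g'') \<in> dist_tri D \<and>
            cmp D u f' = cmp D h' g \<and> cmp D h'' u = f'' \<and>
            cmp D v h' = g' \<and> cmp D g'' v = cmp D (shM D f) h''"

section \<open>The Grothendieck group and the lattice\<close>

definition K_relations :: "('o, 'm, 'z) tri_data_scheme \<Rightarrow> ('o \<Rightarrow>\<^sub>0 int) set" where
  "K_relations D = generate (free_Abelian_group (Ob D))
     {frag_of (tgt D f) - frag_of (src D f) - frag_of (tgt D g) | f g h. (f, g, h) \<in> dist_tri D}"

definition K_group :: "('o, 'm, 'z) tri_data_scheme \<Rightarrow> ('o \<Rightarrow>\<^sub>0 int) set monoid" where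
  "K_group D = free_Abelian_group (Ob D) Mod K_relations D"

definition K_class :: "('o, 'm, 'z) tri_data_scheme \<Rightarrow> 'o \<Rightarrow> ('o \<Rightarrow>\<^sub>0 int) set" where
  "K_class D E = K_relations D #>\<^bsub>free_Abelian_group (Ob D)\<^esub> frag_of E"

definition additive_group :: "'a::ab_group_add monoid" where
  "additive_group = \<lparr>carrier = UNIV, monoid.mult = (+), one = 0\<rparr>"

definition free_of_finite_rank :: "('g, 'w) monoid_scheme \<Rightarrow> bool" where
  "free_of_finite_rank \<Gamma> \<longleftrightarrow> comm_group \<Gamma> \<and> (\<exists>n::nat. free_Abelian_group {..<n} \<cong> \<Gamma>)"

text \<open>
  \<open>realification \<Gamma> \<iota>\<close>: the real vector space \<open>'v\<close>, together with the map
  \<open>\<iota>\<close> (playing the role of \<open>x \<mapsto> x \<otimes> 1\<close>), is the extension of scalars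
  of \<open>\<Gamma>\<close> to the reals, that is, \<open>\<iota>\<close> sends some (equivalently, any) integral
  basis of \<open>\<Gamma>\<close> to a real basis of \<open>'v\<close>.  The chosen norm on it is the norm of the
  type \<open>'v\<close>.
\<close>

definition realification :: "('g, 'w) monoid_scheme \<Rightarrow> ('g \<Rightarrow> 'v::real_vector) \<Rightarrow> bool" where
  "realification \<Gamma> \<iota> \<longleftrightarrow> \<iota> \<in> hom \<Gamma> additive_group \<and>
     (\<exists>(n::nat) b. b \<in> iso (free_Abelian_group {..<n}) \<Gamma> \<and>
        inj_on (\<lambda>i. \<iota> (b (frag_of i))) {..<n} \<and>
        independent ((\<lambda>i. \<iota> (b (frag_of i))) ` {..<n}) \<and>
        span ((\<lambda>i. \<iota> (b (frag_of i))) ` {..<n}) = UNIV)"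

section \<open>Slicings\<close>

text \<open>
  A full subcategory is given by its set of objects.  In a Harder-Narasimhan filtration
  of length \<open>n\<close> the objects are \<open>Es 0, \<dots>, Es n\<close> and the phases are
  \<open>\<phi> 1, \<dots>, \<phi> n\<close>.
\<close>

definition HN_filtration ::
  "('o, 'm, 'z) tri_data_scheme \<Rightarrow> (real \<Rightarrow> 'o set) \<Rightarrow> 'o \<Rightarrow> nat \<Rightarrow> (nat \<Rightarrow> real) \<Rightarrow> bool" where
  "HN_filtration D P E n \<phi> \<longleftrightarrow> (\<exists>Es.
     zero_ob D (Es 0) \<and> Es n = E \<and>
     (\<forall>k \<in> {1..n}. \<exists>A f g h. A \<in> P (\<phi> k) \<and> A \<in> nonzero_obs D \<and>
        f \<in> Hom D (Es (k - 1)) (Es k) \<and> g \<in> Hom D (Es k) A \<and>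
        h \<in> Hom D A (shO D (Es (k - 1))) \<and> (f, g, h) \<in> dist_tri D) \<and>
     (\<forall>j \<in> {1..n}. \<forall>k \<in> {1..n}. j < k \<longrightarrow> \<phi> k < \<phi> j))"

text \<open>
  The subcategories are closed under isomorphism, and \<open>P (\<phi> + 1) = P \<phi>[1]\<close> refers to
  the essential image under the shift.
\<close>

definition slicing :: "('o, 'm, 'z) tri_data_scheme \<Rightarrow> (real \<Rightarrow> 'o set) \<Rightarrow> bool" where
  "slicing D P \<longleftrightarrow>
     (\<forall>\<phi>. P \<phi> \<subseteq> Ob D) \<and>
     (\<forall>\<phi>. \<forall>E \<in> P \<phi>. \<forall>F \<in> Ob D. isomorphic D E F \<longrightarrow> F \<in> P \<phi>) \<and>
     (\<forall>\<phi>. P (\<phi> + 1) = {E \<in> Ob D. \<exists>F \<in> P \<phi>. isomorphic D E (shO D F)}) \<and>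
     (\<forall>\<phi> \<phi>'. \<phi> > \<phi>' \<longrightarrow> (\<forall>E \<in> P \<phi>. \<forall>F \<in> P \<phi>'. Hom D E F = {zerom D E F})) \<and>
     (\<forall>E \<in> nonzero_obs D. \<exists>n \<phi>. HN_filtration D P E n \<phi>)"

text \<open>
  For a slicing, the phases of the Harder-Narasimhan filtrations of a given nonzero object
  are unique, so these descriptions are proper.
\<close>

definition phi_plus :: "('o, 'm, 'z) tri_data_scheme \<Rightarrow> (real \<Rightarrow> 'o set) \<Rightarrow> 'o \<Rightarrow> real" where
  "phi_plus D P E = (THE x. \<exists>n \<phi>. HN_filtration D P E n \<phi> \<and> x = \<phi> 1)"

definition phi_minus :: "('o, 'm, 'z) tri_data_scheme \<Rightarrow> (real \<Rightarrow> 'o set) \<Rightarrow> 'o \<Rightarrow> real" where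
  "phi_minus D P E = (THE x. \<exists>n \<phi>. HN_filtration D P E n \<phi> \<and> x = \<phi> n)"

definition slicing_dist ::
  "('o, 'm, 'z) tri_data_scheme \<Rightarrow> (real \<Rightarrow> 'o set) \<Rightarrow> (real \<Rightarrow> 'o set) \<Rightarrow> ennreal" where
  "slicing_dist D P Q = (SUP E \<in> nonzero_obs D.
     max (ennreal \<bar>phi_plus D P E - phi_plus D Q E\<bar>)
         (ennreal \<bar>phi_minus D P E - phi_minus D Q E\<bar>))"

section \<open>Stability conditions\<close>

definition sigma_semistable ::
  "('o, 'm, 'z) tri_data_scheme \<Rightarrow> (real \<Rightarrow> 'o set) \<Rightarrow> real \<Rightarrow> 'o \<Rightarrow> bool" where
  "sigma_semistable D P \<phi> E \<longleftrightarrow> E \<in> P \<phi> \<and> E \<in> nonzero_obs D"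

definition mono_in :: "('o, 'm, 'z) tri_data_scheme \<Rightarrow> 'o set \<Rightarrow> 'o \<Rightarrow> 'o \<Rightarrow> 'm \<Rightarrow> bool" where
  "mono_in D S A E i \<longleftrightarrow> i \<in> Hom D A E \<and>
     (\<forall>T \<in> S. \<forall>u \<in> Hom D T A. \<forall>v \<in> Hom D T A. cmp D i u = cmp D i v \<longrightarrow> u = v)"

definition simple_in :: "('o, 'm, 'z) tri_data_scheme \<Rightarrow> 'o set \<Rightarrow> 'o \<Rightarrow> bool" where
  "simple_in D S E \<longleftrightarrow> E \<in> S \<and> \<not> zero_ob D E \<and>
     (\<forall>A \<in> S. \<forall>i. mono_in D S A E i \<longrightarrow> zero_ob D A \<or> iso_mor D A E i)"

definition sigma_stable ::
  "('o, 'm, 'z) tri_data_scheme \<Rightarrow> (real \<Rightarrow> 'o set) \<Rightarrow> real \<Rightarrow> 'o \<Rightarrow> bool" where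
  "sigma_stable D P \<phi> E \<longleftrightarrow> simple_in D (P \<phi>) E"

definition stability_condition ::
  "('o, 'm, 'z) tri_data_scheme \<Rightarrow> ('g, 'w) monoid_scheme \<Rightarrow> ('g \<Rightarrow> 'v::real_normed_vector) \<Rightarrow>
   (('o \<Rightarrow>\<^sub>0 int) set \<Rightarrow> 'g) \<Rightarrow> ('g \<Rightarrow> complex) \<Rightarrow> (real \<Rightarrow> 'o set) \<Rightarrow> bool" where
  "stability_condition D \<Gamma> \<iota> cl Z P \<longleftrightarrow>
     Z \<in> hom \<Gamma> additive_group \<and> slicing D P \<and>
     (\<forall>\<phi> E. sigma_semistable D P \<phi> E \<longrightarrow>
        (\<exists>r>0. Z (cl (K_class D E)) = complex_of_real r * exp (\<i> * complex_of_real (pi * \<phi>)))) \<and>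
     (\<exists>\<epsilon>>0. \<forall>\<phi> E. sigma_semistable D P \<phi> E \<longrightarrow>
        norm (Z (cl (K_class D E))) \<ge> \<epsilon> * norm (\<iota> (cl (K_class D E))))"

text \<open>
  As \<open>\<Gamma>\<close> is free of finite rank, the finite-dimensional space of homomorphisms from
  \<open>\<Gamma>\<close> to the complex numbers carries the topology of pointwise convergence.
  Hence both continuity and differentiability are expressed pointwise.
\<close>

definition continuous_family ::
  "('o, 'm, 'z) tri_data_scheme \<Rightarrow> ('g, 'w) monoid_scheme \<Rightarrow> ('g \<Rightarrow> 'v::real_normed_vector) \<Rightarrow>
   (('o \<Rightarrow>\<^sub>0 int) set \<Rightarrow> 'g) \<Rightarrow> 'x::topological_space set \<Rightarrow>
   ('x \<Rightarrow> 'g \<Rightarrow> complex) \<Rightarrow> ('x \<Rightarrow> real \<Rightarrow> 'o set) \<Rightarrow> bool" where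
  "continuous_family D \<Gamma> \<iota> cl M Z P \<longleftrightarrow>
     (\<forall>x \<in> M. stability_condition D \<Gamma> \<iota> cl (Z x) (P x)) \<and>
     (\<forall>\<gamma> \<in> carrier \<Gamma>. continuous_on M (\<lambda>x. Z x \<gamma>)) \<and>
     (\<forall>x \<in> M. \<forall>\<epsilon>>0. \<exists>U. openin (top_of_set M) U \<and> x \<in> U \<and>
        (\<forall>y \<in> U. slicing_dist D (P x) (P y) < ennreal \<epsilon>))"

definition has_derivative_family ::
  "('g, 'w) monoid_scheme \<Rightarrow> real set \<Rightarrow> (real \<Rightarrow> 'g \<Rightarrow> complex) \<Rightarrow> (real \<Rightarrow> 'g \<Rightarrow> complex) \<Rightarrow> bool" where
  "has_derivative_family \<Gamma> M Z Z' \<longleftrightarrow>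
     (\<forall>t \<in> M. \<forall>\<gamma> \<in> carrier \<Gamma>. ((\<lambda>s. Z s \<gamma>) has_vector_derivative Z' t \<gamma>) (at t within M))"

end

theory Submission
  imports Defs
begin

text \<open>
  Fix \<open>E\<close> and compare \<open>t\<close> with a nearby \<open>t0\<close>. The first Harder--Narasimhan factor \<open>F\<close> of \<open>E\<close> at
  \<open>t0\<close> satisfies \<open>\<phi>\<^sup>+\<^sub>t(F) \<le> \<phi>\<^sup>+\<^sub>t(E)\<close>, and \<open>\<phi>\<^sup>+\<^sub>t(F)\<close> is at least the argument of \<open>Z\<^sub>t(F)\<close>,
  which to first order does not decrease at \<open>t0\<close>. Hence the lower right Dini derivative of the
  continuous function \<open>t \<mapsto> \<phi>\<^sup>+\<^sub>t(E)\<close> is nonnegative, so the function is increasing. Dually, the last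
  factor controls the left Dini derivative of \<open>t \<mapsto> \<phi>\<^sup>-\<^sub>t(E)\<close>. The hypothesis on stable objects
  extends to semistable ones because, by the support property, every semistable object is a
  finite iterated extension of stable ones.
\<close>

section \<open>Exact Hom sequences\<close>

text \<open>The charge of a fixed object controls its phases from one side only: when the phases of
  \<open>F\<close> at \<open>t\<close> lie within a half turn, the argument of \<open>W t F\<close>
  is between the smallest and the largest of them, so it bounds the largest from below and the
  smallest from above. Hence the pairing of \<open>phi_plus\<close> with the first factor and right
  derivatives, and of \<open>phi_minus\<close> with the last factor and left derivatives. The time
  for which the first-order estimate holds depends on \<open>F\<close>, so \<open>F\<close> is
  frozen at \<open>t0\<close> and followed to nearby \<open>t\<close>, where it need not be
  semistable any more. As the hypothesis allows a zero derivative, the charge is compared with a ray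
  whose phase moves backwards at speed \<open>\<epsilon>\<close>; this makes the comparison strict,
  and \<open>\<epsilon>\<close> tends to 0 at the end. Phases are handled as statements about
  vanishing Hom, which exact sequences carry from the filtration at \<open>t0\<close> to the slicing
  at \<open>t\<close>, and arguments of charges through the sign of an imaginary part after
  rotation.\<close>

definition hom_zero :: "('o, 'm, 'z) tri_data_scheme \<Rightarrow> 'o \<Rightarrow> 'o \<Rightarrow> bool" where
  "hom_zero D X Y \<longleftrightarrow> (\<forall>f \<in> Hom D X Y. f = zerom D X Y)"

definition triangle ::
  "('o, 'm, 'z) tri_data_scheme \<Rightarrow> 'o \<Rightarrow> 'o \<Rightarrow> 'o \<Rightarrow> 'm \<Rightarrow> 'm \<Rightarrow> 'm \<Rightarrow> bool" where
  "triangle D X Y C f g h \<longleftrightarrow>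
     f \<in> Hom D X Y \<and> g \<in> Hom D Y C \<and> h \<in> Hom D C (shO D X) \<and> (f, g, h) \<in> dist_tri D"

lemma (in category) Hom_Ob: "f \<in> Hom D X Y \<Longrightarrow> X \<in> Ob D \<and> Y \<in> Ob D"
  using src_Ob tgt_Ob by (auto simp: Hom_def)

section \<open>Zero morphisms, negatives and zero objects\<close>

context additive_category
begin

lemma zerom_Hom: "\<lbrakk>X \<in> Ob D; Y \<in> Ob D\<rbrakk> \<Longrightarrow> zerom D X Y \<in> Hom D X Y"
proof -
  assume "X \<in> Ob D" "Y \<in> Ob D"
  then interpret G: comm_group "hom_group D X Y" by (rule hom_comm_group)
  show ?thesis using G.one_closed by (simp add: hom_group_def)
qed

lemma addm_idem_imp_zero:
  assumes "f \<in> Hom D X Y" "addm D f f = f"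
  shows "f = zerom D X Y"
proof -
  interpret G: comm_group "hom_group D X Y" using assms Hom_Ob hom_comm_group by blast
  show ?thesis using G.l_cancel_one[of f f] assms by (simp add: hom_group_def)
qed

lemma addm_zero: "f \<in> Hom D X Y \<Longrightarrow> addm D f (zerom D X Y) = f"
proof -
  assume f: "f \<in> Hom D X Y"
  interpret G: comm_group "hom_group D X Y" using f Hom_Ob hom_comm_group by blast
  show ?thesis using G.r_one[of f] f by (simp add: hom_group_def)
qed

lemma cmp_zero_right:
  assumes "g \<in> Hom D Y V" "X \<in> Ob D"
  shows "cmp D g (zerom D X Y) = zerom D X V"
proof (rule addm_idem_imp_zero)
  have Y: "Y \<in> Ob D" using assms Hom_Ob by blast
  note z = zerom_Hom[OF assms(2) Y]
  show "cmp D g (zerom D X Y) \<in> Hom D X V" using cmp_Hom[OF z assms(1)] .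
  show "addm D (cmp D g (zerom D X Y)) (cmp D g (zerom D X Y)) = cmp D g (zerom D X Y)"
    using cmp_add_right[OF z z assms(1)] addm_zero[OF z] by simp
qed

lemma cmp_zero_left:
  assumes "f \<in> Hom D X Y" "V \<in> Ob D"
  shows "cmp D (zerom D Y V) f = zerom D X V"
proof (rule addm_idem_imp_zero)
  have Y: "Y \<in> Ob D" using assms Hom_Ob by blast
  note z = zerom_Hom[OF Y assms(2)]
  show "cmp D (zerom D Y V) f \<in> Hom D X V" using cmp_Hom[OF assms(1) z] .
  show "addm D (cmp D (zerom D Y V) f) (cmp D (zerom D Y V) f) = cmp D (zerom D Y V) f"
    using cmp_add_left[OF assms(1) z z] addm_zero[OF z] by simp
qed

lemma negm_Hom: "f \<in> Hom D X Y \<Longrightarrow> negm D f \<in> Hom D X Y"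
proof -
  assume f: "f \<in> Hom D X Y"
  interpret G: comm_group "hom_group D X Y" using f Hom_Ob hom_comm_group by blast
  show ?thesis using G.inv_closed[of f] f by (simp add: hom_group_def negm_def Hom_def)
qed

lemma addm_negm: "f \<in> Hom D X Y \<Longrightarrow> addm D f (negm D f) = zerom D X Y"
proof -
  assume f: "f \<in> Hom D X Y"
  interpret G: comm_group "hom_group D X Y" using f Hom_Ob hom_comm_group by blast
  show ?thesis using G.r_inv[of f] f by (simp add: hom_group_def negm_def Hom_def)
qed

lemma negm_unique:
  assumes "f \<in> Hom D X Y" "g \<in> Hom D X Y" "addm D f g = zerom D X Y"
  shows "g = negm D f"
proof -
  interpret G: comm_group "hom_group D X Y" using assms Hom_Ob hom_comm_group by blast
  have "inv\<^bsub>hom_group D X Y\<^esub> f = g"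
    using G.inv_equality[of g f] G.m_comm[of f g] assms by (simp add: hom_group_def)
  then show ?thesis using assms by (simp add: negm_def Hom_def)
qed

lemma negm_negm: "f \<in> Hom D X Y \<Longrightarrow> negm D (negm D f) = f"
proof -
  assume f: "f \<in> Hom D X Y"
  interpret G: comm_group "hom_group D X Y" using f Hom_Ob hom_comm_group by blast
  show ?thesis using G.inv_inv[of f] f negm_Hom[OF f] by (simp add: hom_group_def negm_def Hom_def)
qed

lemma negm_zerom: "\<lbrakk>X \<in> Ob D; Y \<in> Ob D\<rbrakk> \<Longrightarrow> negm D (zerom D X Y) = zerom D X Y"
  using negm_unique addm_zero zerom_Hom by metis

lemma cmp_negm_right:
  assumes "f \<in> Hom D X Y" "g \<in> Hom D Y V"
  shows "cmp D g (negm D f) = negm D (cmp D g f)"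
proof (rule negm_unique)
  show "addm D (cmp D g f) (cmp D g (negm D f)) = zerom D X V"
    using cmp_add_right[OF assms(1) negm_Hom[OF assms(1)] assms(2)] addm_negm[OF assms(1)]
      cmp_zero_right[OF assms(2)] Hom_Ob[OF assms(1)] by simp
qed (use assms cmp_Hom negm_Hom in blast)+

lemma cmp_negm_left:
  assumes "f \<in> Hom D X Y" "g \<in> Hom D Y V"
  shows "cmp D (negm D g) f = negm D (cmp D g f)"
proof (rule negm_unique)
  show "addm D (cmp D g f) (cmp D (negm D g) f) = zerom D X V"
    using cmp_add_left[OF assms(1) assms(2) negm_Hom[OF assms(2)]] addm_negm[OF assms(2)]
      cmp_zero_left[OF assms(1)] Hom_Ob[OF assms(2)] by simp
qed (use assms cmp_Hom negm_Hom in blast)+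

lemma zero_ob_Ob: "zero_ob D N \<Longrightarrow> N \<in> Ob D"
  by (simp add: zero_ob_def)

lemma hom_zero_to_zero_ob: "zero_ob D N \<Longrightarrow> hom_zero D X N"
  unfolding hom_zero_def by (metis Hom_Ob zerom_Hom zero_ob_def)

lemma hom_zero_from_zero_ob: "zero_ob D N \<Longrightarrow> hom_zero D N X"
  unfolding hom_zero_def by (metis Hom_Ob zerom_Hom zero_ob_def)

lemma idn_eq_zerom_imp_zero_ob:
  assumes "N \<in> Ob D" "idn D N = zerom D N N"
  shows "zero_ob D N"
proof -
  have "f = zerom D X N" if "f \<in> Hom D X N" for f X
    using that cmp_idn_left[OF that] assms cmp_zero_left[OF that] by metis
  moreover have "f = zerom D N X" if "f \<in> Hom D N X" for f X
    using that cmp_idn_right[OF that] assms cmp_zero_right[OF that] by metis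
  ultimately show ?thesis unfolding zero_ob_def using assms(1) zerom_Hom by metis
qed

lemma zero_ob_iff: "N \<in> Ob D \<Longrightarrow> zero_ob D N \<longleftrightarrow> hom_zero D N N"
  using idn_eq_zerom_imp_zero_ob idn_Hom hom_zero_to_zero_ob unfolding hom_zero_def by blast

lemma nonzero_not_hom_zero: "A \<in> nonzero_obs D \<Longrightarrow> \<not> hom_zero D A A"
  unfolding nonzero_obs_def using zero_ob_iff by blast

lemma isomorphic_refl: "X \<in> Ob D \<Longrightarrow> isomorphic D X X"
  unfolding isomorphic_def iso_mor_def using idn_Hom cmp_idn_left by metis

lemma isomorphic_sym: "isomorphic D X Y \<Longrightarrow> isomorphic D Y X"
  unfolding isomorphic_def iso_mor_def by blast

lemma hom_zero_iso_right:
  assumes "isomorphic D Y Y'" "hom_zero D X Y"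
  shows "hom_zero D X Y'"
  unfolding hom_zero_def
proof
  fix u assume u: "u \<in> Hom D X Y'"
  obtain f g where f: "f \<in> Hom D Y Y'" and g: "g \<in> Hom D Y' Y" and fg: "cmp D f g = idn D Y'"
    using assms(1) by (auto simp: isomorphic_def iso_mor_def)
  have "u = cmp D f (cmp D g u)"
    using cmp_assoc[OF u g f] cmp_idn_left[OF u] fg by simp
  also have "cmp D g u = zerom D X Y"
    using assms(2) cmp_Hom[OF u g] by (simp add: hom_zero_def)
  finally show "u = zerom D X Y'"
    using cmp_zero_right[OF f] Hom_Ob[OF u] by simp
qed

lemma hom_zero_iso_left:
  assumes "isomorphic D X X'" "hom_zero D X Y"
  shows "hom_zero D X' Y"
  unfolding hom_zero_def
proof
  fix u assume u: "u \<in> Hom D X' Y"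
  obtain f g where f: "f \<in> Hom D X X'" and g: "g \<in> Hom D X' X" and fg: "cmp D f g = idn D X'"
    using assms(1) by (auto simp: isomorphic_def iso_mor_def)
  have "u = cmp D (cmp D u f) g"
    using cmp_assoc[OF g f u] cmp_idn_right[OF u] fg by simp
  also have "cmp D u f = zerom D X Y"
    using assms(2) cmp_Hom[OF f u] by (simp add: hom_zero_def)
  finally show "u = zerom D X' Y"
    using cmp_zero_left[OF g] Hom_Ob[OF u] by simp
qed

end

section \<open>Shift, rotation, lifting and extension along triangles\<close>

context triangulated_category
begin

lemma shM_Hom: "f \<in> Hom D X Y \<Longrightarrow> shM D f \<in> Hom D (shO D X) (shO D Y)"
  using shM_fully_faithful Hom_Ob by (meson bij_betwE)

lemma shM_inj: "\<lbrakk>f \<in> Hom D X Y; g \<in> Hom D X Y; shM D f = shM D g\<rbrakk> \<Longrightarrow> f = g"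
  using shM_fully_faithful[of X Y] Hom_Ob by (metis bij_betw_imp_inj_on inj_onD)

lemma shM_surj:
  "\<lbrakk>X \<in> Ob D; Y \<in> Ob D; g \<in> Hom D (shO D X) (shO D Y)\<rbrakk> \<Longrightarrow> \<exists>f \<in> Hom D X Y. g = shM D f"
  using shM_fully_faithful[of X Y] by (metis bij_betw_imp_surj_on imageE)

lemma shM_zerom: "\<lbrakk>X \<in> Ob D; Y \<in> Ob D\<rbrakk> \<Longrightarrow> shM D (zerom D X Y) = zerom D (shO D X) (shO D Y)"
  using addm_idem_imp_zero shM_Hom shM_add zerom_Hom addm_zero by metis

lemma shM_eq_zerom: "f \<in> Hom D X Y \<Longrightarrow> shM D f = zerom D (shO D X) (shO D Y) \<Longrightarrow> f = zerom D X Y"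
  using shM_inj shM_zerom zerom_Hom Hom_Ob by metis

lemma hom_zero_shift:
  "\<lbrakk>X \<in> Ob D; Y \<in> Ob D; hom_zero D X Y\<rbrakk> \<Longrightarrow> hom_zero D (shO D X) (shO D Y)"
  unfolding hom_zero_def using shM_surj shM_zerom by metis

lemma zero_ob_shift: "zero_ob D N \<Longrightarrow> zero_ob D (shO D N)"
  using zero_ob_iff hom_zero_shift zero_ob_Ob shO_Ob by metis

lemma triangle_exists:
  assumes "f \<in> Hom D X Y"
  obtains C g h where "triangle D X Y C f g h"
proof -
  have "f \<in> Mor D" using assms by (simp add: Hom_def)
  from TR1_cone[OF this] obtain g h where t: "(f, g, h) \<in> dist_tri D" by blast
  from dist_tri_Hom[OF t] obtain X' Y' C where
    "f \<in> Hom D X' Y'" "g \<in> Hom D Y' C" "h \<in> Hom D C (shO D X')" by blast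
  then show thesis using t assms that[of C g h] by (auto simp: triangle_def Hom_def)
qed

lemma triangle_Ob: "triangle D X Y C f g h \<Longrightarrow> X \<in> Ob D \<and> Y \<in> Ob D \<and> C \<in> Ob D"
  using Hom_Ob unfolding triangle_def by blast

lemma triangle_rotate:
  "triangle D X Y C f g h \<Longrightarrow> triangle D Y C (shO D X) g h (negm D (shM D f))"
  unfolding triangle_def using TR2 shM_Hom negm_Hom by metis

lemma triangle_idn_zero:
  "\<lbrakk>X \<in> Ob D; zero_ob D N\<rbrakk> \<Longrightarrow>
    triangle D X X N (idn D X) (zerom D X N) (zerom D N (shO D X))"
  unfolding triangle_def using TR1_idn idn_Hom zerom_Hom zero_ob_Ob shO_Ob by metis

text \<open>Rotating it gives the identity triangle on \<open>X\<close> with third vertex the zero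
  object \<open>shO D N\<close>; TR2, being an equivalence, is read backwards.\<close>

lemma triangle_zero_idn:
  assumes "X \<in> Ob D" "zero_ob D N"
  shows "triangle D N X X (zerom D N X) (idn D X) (zerom D X (shO D N))"
proof -
  note [simp] = zero_ob_Ob[OF assms(2)] shO_Ob zerom_Hom idn_Hom assms(1)
  have "negm D (shM D (zerom D N X)) = zerom D (shO D N) (shO D X)"
    by (simp add: shM_zerom negm_zerom)
  then show ?thesis
    using triangle_idn_zero[OF assms(1) zero_ob_shift[OF assms(2)]]
      TR2[of "zerom D N X" N X "idn D X" X "zerom D X (shO D N)"]
    unfolding triangle_def by simp
qed

text \<open>TR3 extends \<open>idn D X\<close> and \<open>f\<close> to a morphism from the identity
  triangle on \<open>X\<close>, so the composite factors through a zero object.\<close>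

lemma triangle_cmp_zero:
  assumes "triangle D X Y C f g h"
  shows "cmp D g f = zerom D X C"
proof -
  obtain N where N: "zero_ob D N" using ex_zero_ob by blast
  have X: "X \<in> Ob D" using triangle_Ob[OF assms] by blast
  have f: "f \<in> Hom D X Y" using assms by (simp add: triangle_def)
  obtain c where c: "c \<in> Hom D N C" "cmp D c (zerom D X N) = cmp D g f"
    using TR3[of "idn D X" "zerom D X N" "zerom D N (shO D X)" f g h X X N X Y C "idn D X" f]
      triangle_idn_zero[OF X N] assms unfolding triangle_def using idn_Hom[OF X] by metis
  then show ?thesis using cmp_zero_right[OF c(1) X] by simp
qed

text \<open>\<open>u\<close> and the zero map \<open>0 \<rightarrow> C\<close> extend to a morphism of triangles
  from the rotation of \<open>T \<rightarrow> T \<rightarrow> 0\<close> to the rotation of the given triangle; its third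
  component is the shift of the lift.\<close>

lemma triangle_lift:
  assumes t: "triangle D X Y C f g h" and u: "u \<in> Hom D T Y" and gu: "cmp D g u = zerom D T C"
  shows "\<exists>v \<in> Hom D T X. cmp D f v = u"
proof -
  obtain N where N: "zero_ob D N" using ex_zero_ob by blast
  have T: "T \<in> Ob D" using Hom_Ob[OF u] by blast
  have Ob: "X \<in> Ob D" "Y \<in> Ob D" "C \<in> Ob D" "N \<in> Ob D"
    using triangle_Ob[OF t] zero_ob_Ob[OF N] by auto
  have f: "f \<in> Hom D X Y" using t by (simp add: triangle_def)
  note r1 = triangle_rotate[OF triangle_idn_zero[OF T N]]
  note r2 = triangle_rotate[OF t]
  have "cmp D (zerom D N C) (zerom D T N) = cmp D g u"
    using cmp_zero_right[OF zerom_Hom[OF Ob(4,3)] T] gu by simp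
  then obtain c where c: "c \<in> Hom D (shO D T) (shO D X)"
    and eq: "cmp D (shM D u) (negm D (shM D (idn D T))) = cmp D (negm D (shM D f)) c"
    using TR3[of _ _ _ g h "negm D (shM D f)" T N "shO D T" Y C "shO D X" u "zerom D N C"]
      r1 r2 u zerom_Hom[OF Ob(4,3)] unfolding triangle_def by metis
  obtain v where v: "v \<in> Hom D T X" "c = shM D v" using shM_surj[OF T Ob(1) c] by blast
  note i = idn_Hom[OF T]
  have "cmp D (shM D u) (negm D (shM D (idn D T))) = negm D (shM D u)"
    using cmp_negm_right[OF shM_Hom[OF i] shM_Hom[OF u]] shM_cmp[OF i u] cmp_idn_right[OF u] by simp
  moreover have "cmp D (negm D (shM D f)) c = negm D (shM D (cmp D f v))"
    using cmp_negm_left[OF shM_Hom[OF v(1)] shM_Hom[OF f]] shM_cmp[OF v(1) f] v(2) by simp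
  ultimately have "negm D (shM D u) = negm D (shM D (cmp D f v))" using eq by simp
  then have "shM D u = shM D (cmp D f v)"
    using negm_negm shM_Hom u cmp_Hom[OF v(1) f] by metis
  then show ?thesis using shM_inj[OF u cmp_Hom[OF v(1) f]] v(1) by auto
qed

text \<open>Dual to \<open>triangle_lift\<close>, but without rotation: TR3 maps the given triangle
  to the triangle on \<open>N\<close>, \<open>T\<close>, \<open>T\<close>, and its third component
  is the extension.\<close>

lemma triangle_extend:
  assumes t: "triangle D X Y C f g h" and u: "u \<in> Hom D Y T" and uf: "cmp D u f = zerom D X T"
  shows "\<exists>v \<in> Hom D C T. cmp D v g = u"
proof -
  obtain N where N: "zero_ob D N" using ex_zero_ob by blast
  have T: "T \<in> Ob D" using Hom_Ob[OF u] by blast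
  have Ob: "X \<in> Ob D" "N \<in> Ob D" using triangle_Ob[OF t] zero_ob_Ob[OF N] by auto
  have z: "zerom D X N \<in> Hom D X N" "zerom D N T \<in> Hom D N T" using Ob T zerom_Hom by auto
  have "cmp D u f = cmp D (zerom D N T) (zerom D X N)"
    using cmp_zero_right[OF z(2) Ob(1)] uf by simp
  then obtain c where c: "c \<in> Hom D C T" "cmp D c g = cmp D (idn D T) u"
    using TR3[of f g h "zerom D N T" "idn D T" "zerom D T (shO D N)" X Y C N T T "zerom D X N" u]
      t triangle_zero_idn[OF T N] u z unfolding triangle_def by metis
  then show ?thesis using cmp_idn_left[OF u] by auto
qed

lemma hom_zero_middle_to:
  assumes t: "triangle D X Y C f g h" and "hom_zero D T X" "hom_zero D T C"
  shows "hom_zero D T Y"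
  unfolding hom_zero_def
proof
  fix u assume u: "u \<in> Hom D T Y"
  have fg: "f \<in> Hom D X Y" "g \<in> Hom D Y C" using t by (auto simp: triangle_def)
  have "cmp D g u = zerom D T C" using assms(3) cmp_Hom[OF u fg(2)] by (simp add: hom_zero_def)
  then obtain v where "v \<in> Hom D T X" "cmp D f v = u" using triangle_lift[OF t u] by blast
  then show "u = zerom D T Y"
    using assms(2) cmp_zero_right[OF fg(1)] Hom_Ob[OF u] by (auto simp: hom_zero_def)
qed

lemma hom_zero_middle_from:
  assumes t: "triangle D X Y C f g h" and "hom_zero D X T" "hom_zero D C T"
  shows "hom_zero D Y T"
  unfolding hom_zero_def
proof
  fix u assume u: "u \<in> Hom D Y T"
  have fg: "f \<in> Hom D X Y" "g \<in> Hom D Y C" using t by (auto simp: triangle_def)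
  have "cmp D u f = zerom D X T" using assms(2) cmp_Hom[OF fg(1) u] by (simp add: hom_zero_def)
  then obtain v where "v \<in> Hom D C T" "cmp D v g = u" using triangle_extend[OF t u] by blast
  then show "u = zerom D Y T"
    using assms(3) cmp_zero_left[OF fg(2)] Hom_Ob[OF u] by (auto simp: hom_zero_def)
qed

lemma hom_zero_cone_to:
  "\<lbrakk>triangle D X Y C f g h; hom_zero D T Y; hom_zero D T (shO D X)\<rbrakk> \<Longrightarrow> hom_zero D T C"
  using hom_zero_middle_to triangle_rotate by blast

lemma hom_zero_cone_from:
  "\<lbrakk>triangle D X Y C f g h; hom_zero D Y T; hom_zero D (shO D X) T\<rbrakk> \<Longrightarrow> hom_zero D C T"
  using hom_zero_middle_from triangle_rotate by blast

text \<open>Rotation only goes forward, so the vanishing is proved for \<open>shO D X\<close>, the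
  third vertex of the rotated triangle, and brought back by full faithfulness of the shift.\<close>

lemma hom_zero_first_to:
  assumes t: "triangle D X Y C f g h" and "T \<in> Ob D" "hom_zero D T Y" "hom_zero D (shO D T) C"
  shows "hom_zero D T X"
proof -
  have "hom_zero D (shO D T) (shO D X)"
    using hom_zero_cone_to[OF triangle_rotate[OF t] assms(4)] hom_zero_shift assms(2,3)
      triangle_Ob[OF t] by blast
  then show ?thesis
    unfolding hom_zero_def using shM_Hom shM_eq_zerom by metis
qed

text \<open>Extending \<open>idn D Y\<close> along \<open>g\<close> and lifting
  \<open>idn D C\<close> through \<open>g\<close> give a left and a right inverse of
  \<open>g\<close>, which must coincide.\<close>

lemma triangle_zero_first_iso:
  assumes t: "triangle D N Y C f g h" and N: "zero_ob D N"
  shows "isomorphic D Y C"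
proof -
  have Ob: "Y \<in> Ob D" "C \<in> Ob D" and g: "g \<in> Hom D Y C" and f: "f \<in> Hom D N Y"
    and h: "h \<in> Hom D C (shO D N)"
    using triangle_Ob[OF t] t by (auto simp: triangle_def)
  have "cmp D (idn D Y) f = zerom D N Y"
    using hom_zero_from_zero_ob[OF N] cmp_idn_left[OF f] f by (simp add: hom_zero_def)
  then obtain v where v: "v \<in> Hom D C Y" "cmp D v g = idn D Y"
    using triangle_extend[OF t idn_Hom[OF Ob(1)]] by blast
  have "cmp D h (idn D C) = zerom D C (shO D N)"
    using hom_zero_to_zero_ob[OF zero_ob_shift[OF N]] cmp_idn_right[OF h] h by (simp add: hom_zero_def)
  then obtain w where w: "w \<in> Hom D C Y" "cmp D g w = idn D C"
    using triangle_lift[OF triangle_rotate[OF t] idn_Hom[OF Ob(2)]] by blast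
  have "v = w"
    using cmp_assoc[OF w(1) g v(1)] v w cmp_idn_left cmp_idn_right by metis
  then show ?thesis using v w g by (auto simp: isomorphic_def iso_mor_def)
qed

lemma triangle_zero_cone_iso:
  assumes t: "triangle D X Y C f g h" and C: "zero_ob D C"
  shows "iso_mor D X Y f"
proof -
  have Ob: "X \<in> Ob D" "Y \<in> Ob D" and f: "f \<in> Hom D X Y" and g: "g \<in> Hom D Y C"
    and h: "h \<in> Hom D C (shO D X)"
    using triangle_Ob[OF t] t by (auto simp: triangle_def)
  have "cmp D g (idn D Y) = zerom D Y C"
    using hom_zero_to_zero_ob[OF C] cmp_idn_right[OF g] g by (simp add: hom_zero_def)
  then obtain v where v: "v \<in> Hom D Y X" "cmp D f v = idn D Y"
    using triangle_lift[OF t idn_Hom[OF Ob(2)]] by blast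
  have "cmp D (idn D (shO D X)) h = zerom D C (shO D X)"
    using hom_zero_from_zero_ob[OF C] cmp_idn_left[OF h] h by (simp add: hom_zero_def)
  \<comment> \<open>In the twice rotated triangle the second arrow is \<open>f\<close> shifted, with
    a sign. Extending the identity along it gives \<open>w\<close>, and \<open>negm D w\<close>
    unshifts to a left inverse of \<open>f\<close>.\<close>
  then obtain w where w: "w \<in> Hom D (shO D Y) (shO D X)"
      "cmp D w (negm D (shM D f)) = idn D (shO D X)"
    using triangle_extend[OF triangle_rotate[OF triangle_rotate[OF t]] idn_Hom[OF shO_Ob[OF Ob(1)]]]
    by blast
  obtain w' where w': "w' \<in> Hom D Y X" "negm D w = shM D w'"
    using shM_surj[OF Ob(2,1) negm_Hom[OF w(1)]] by blast
  have "shM D (cmp D w' f) = shM D (idn D X)"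
    using shM_cmp[OF f w'(1)] w'(2) w(2) cmp_negm_left[OF shM_Hom[OF f] w(1)]
      cmp_negm_right[OF shM_Hom[OF f] w(1)] shM_idn[OF Ob(1)] by simp
  then have w'f: "cmp D w' f = idn D X"
    using shM_inj cmp_Hom[OF f w'(1)] idn_Hom[OF Ob(1)] by blast
  have "v = w'"
    using cmp_assoc[OF v(1) f w'(1)] w'f v w' cmp_idn_left cmp_idn_right by metis
  then show ?thesis using v w'f f by (auto simp: iso_mor_def)
qed

text \<open>A map from \<open>shO D B\<close> to \<open>C\<close>, followed by \<open>q\<close>, is
  the shift of some \<open>w\<close> from \<open>B\<close> to \<open>A\<close> that \<open>i\<close>
  kills. Since \<open>i\<close> is monic against \<open>B\<close>, \<open>w\<close> is zero, so the
  map lifts to \<open>E\<close>, where it vanishes.\<close>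

lemma mono_shift_hom_zero:
  assumes mono: "mono_in D S A E i" and t: "triangle D A E C i p q"
    and B: "B \<in> S" and B_Ob: "B \<in> Ob D" and BE: "hom_zero D (shO D B) E"
  shows "hom_zero D (shO D B) C"
  unfolding hom_zero_def
proof
  fix u assume u: "u \<in> Hom D (shO D B) C"
  have i: "i \<in> Hom D A E" and p: "p \<in> Hom D E C" and q: "q \<in> Hom D C (shO D A)"
    using t by (auto simp: triangle_def)
  have qu: "cmp D q u \<in> Hom D (shO D B) (shO D A)" using cmp_Hom[OF u q] .
  have "cmp D (negm D (shM D i)) q = zerom D C (shO D E)"
    using triangle_cmp_zero[OF triangle_rotate[OF triangle_rotate[OF t]]] .
  then have "negm D (cmp D (shM D i) (cmp D q u)) = zerom D (shO D B) (shO D E)"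
    using cmp_assoc[OF u q negm_Hom[OF shM_Hom[OF i]]] cmp_negm_left[OF qu shM_Hom[OF i]]
      cmp_zero_left[OF u] Hom_Ob[OF shM_Hom[OF i]] by simp
  then have *: "cmp D (shM D i) (cmp D q u) = zerom D (shO D B) (shO D E)"
    using negm_negm[OF cmp_Hom[OF qu shM_Hom[OF i]]] negm_zerom Hom_Ob[OF qu] Hom_Ob[OF shM_Hom[OF i]]
    by metis
  obtain w where w: "w \<in> Hom D B A" "cmp D q u = shM D w"
    using shM_surj[OF B_Ob _ qu] Hom_Ob[OF i] by blast
  have "shM D (cmp D i w) = zerom D (shO D B) (shO D E)"
    using * w shM_cmp[OF w(1) i] by simp
  then have "cmp D i w = cmp D i (zerom D B A)"
    using shM_eq_zerom[OF cmp_Hom[OF w(1) i]] cmp_zero_right[OF i B_Ob] by simp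
  then have "w = zerom D B A"
    using mono B w(1) zerom_Hom[OF B_Ob] Hom_Ob[OF i] unfolding mono_in_def by blast
  then have "cmp D q u = zerom D (shO D B) (shO D A)"
    using w(2) shM_zerom[OF B_Ob] Hom_Ob[OF i] by simp
  then obtain v where "v \<in> Hom D (shO D B) E" "cmp D p v = u"
    using triangle_lift[OF triangle_rotate[OF t] u] by blast
  then show "u = zerom D (shO D B) C"
    using BE cmp_zero_right[OF p] Hom_Ob[OF u] by (auto simp: hom_zero_def)
qed

end

section \<open>Extreme phases of Harder--Narasimhan filtrations\<close>

text \<open>\<open>HN_filtration\<close> hides the steps and factors behind quantifiers; the
  estimates have to name the first and the last factor, so both sequences are exposed here.\<close>

definition HN_data ::
  "('o, 'm, 'z) tri_data_scheme \<Rightarrow> (real \<Rightarrow> 'o set) \<Rightarrow> 'o \<Rightarrow> nat \<Rightarrow> (nat \<Rightarrow> real) \<Rightarrow>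
    (nat \<Rightarrow> 'o) \<Rightarrow> (nat \<Rightarrow> 'o) \<Rightarrow> bool" where
  "HN_data D P E n \<phi> Es A \<longleftrightarrow>
     zero_ob D (Es 0) \<and> Es n = E \<and>
     (\<forall>k \<in> {1..n}. A k \<in> P (\<phi> k) \<and> A k \<in> nonzero_obs D \<and>
        (\<exists>f g h. triangle D (Es (k - 1)) (Es k) (A k) f g h)) \<and>
     (\<forall>j \<in> {1..n}. \<forall>k \<in> {1..n}. j < k \<longrightarrow> \<phi> k < \<phi> j)"

lemma HN_filtration_iff_data: "HN_filtration D P E n \<phi> \<longleftrightarrow> (\<exists>Es A. HN_data D P E n \<phi> Es A)"
proof -
  define Q where "Q Es k A \<longleftrightarrow> A \<in> P (\<phi> k) \<and> A \<in> nonzero_obs D \<and>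
      (\<exists>f g h. triangle D (Es (k - 1)) (Es k) A f g h)" for Es k A
  have "(\<forall>k \<in> {1..n}. \<exists>A. Q Es k A) \<longleftrightarrow> (\<exists>A. \<forall>k \<in> {1..n}. Q Es k (A k))" for Es
    by (rule bchoice_iff)
  then show ?thesis
    unfolding HN_filtration_def HN_data_def triangle_def Q_def by simp
qed

locale sliced_category = triangulated_category D
  for D :: "('o, 'm, 'z) tri_data_scheme" +
  fixes P :: "real \<Rightarrow> 'o set"
  assumes slicing: "slicing D P"
begin

lemma slice_Ob: "A \<in> P \<phi> \<Longrightarrow> A \<in> Ob D"
  using slicing unfolding slicing_def by blast

lemma slice_iso: "\<lbrakk>A \<in> P \<phi>; B \<in> Ob D; isomorphic D A B\<rbrakk> \<Longrightarrow> B \<in> P \<phi>"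
  using slicing unfolding slicing_def by blast

lemma slice_plus_1: "P (\<phi> + 1) = {E \<in> Ob D. \<exists>F \<in> P \<phi>. isomorphic D E (shO D F)}"
  using slicing unfolding slicing_def by blast

lemma slice_hom_zero: "\<lbrakk>A \<in> P \<phi>; B \<in> P \<psi>; \<psi> < \<phi>\<rbrakk> \<Longrightarrow> hom_zero D A B"
  using slicing unfolding slicing_def hom_zero_def by blast

lemma slice_shift: "A \<in> P \<phi> \<Longrightarrow> shO D A \<in> P (\<phi> + 1)"
  unfolding slice_plus_1 using shO_Ob slice_Ob isomorphic_refl by blast

lemma slice_unshift:
  assumes "A \<in> P \<phi>"
  obtains B where "B \<in> P (\<phi> - 1)" "isomorphic D A (shO D B)"
proof -
  have "A \<in> P (\<phi> - 1 + 1)" using assms by simp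
  then show thesis unfolding slice_plus_1 using that by blast
qed

text \<open>Up to isomorphism \<open>T\<close> is the shift of an object of phase
  \<open>\<psi> - 1\<close>, so maps out of \<open>shO D X\<close> come from maps out of
  \<open>X\<close>.\<close>

lemma hom_zero_shift_slice:
  assumes "X \<in> Ob D" "T \<in> P \<psi>" "\<And>T'. T' \<in> P (\<psi> - 1) \<Longrightarrow> hom_zero D X T'"
  shows "hom_zero D (shO D X) T"
proof -
  obtain T' where T': "T' \<in> P (\<psi> - 1)" "isomorphic D T (shO D T')"
    using slice_unshift assms(2) by blast
  show ?thesis
    using hom_zero_iso_right[OF isomorphic_sym[OF T'(2)] hom_zero_shift[OF assms(1) slice_Ob[OF T'(1)]]]
      assms(3)[OF T'(1)] by blast
qed

lemma HN_length_pos: "HN_data D P E n \<phi> Es A \<Longrightarrow> E \<in> nonzero_obs D \<Longrightarrow> 1 \<le> n"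
  unfolding HN_data_def nonzero_obs_def by (cases n) auto

lemma HN_triangle:
  "\<lbrakk>HN_data D P E n \<phi> Es A; 1 \<le> k; k \<le> n\<rbrakk> \<Longrightarrow>
    \<exists>f g h. triangle D (Es (k - 1)) (Es k) (A k) f g h"
  unfolding HN_data_def by simp

lemma HN_triangle_Suc:
  "\<lbrakk>HN_data D P E n \<phi> Es A; k < n\<rbrakk> \<Longrightarrow> \<exists>f g h. triangle D (Es k) (Es (Suc k)) (A (Suc k)) f g h"
  using HN_triangle[of E n \<phi> Es A "Suc k"] by simp

lemma HN_factor:
  "\<lbrakk>HN_data D P E n \<phi> Es A; k \<in> {1..n}\<rbrakk> \<Longrightarrow> A k \<in> P (\<phi> k) \<and> A k \<in> nonzero_obs D"
  unfolding HN_data_def by blast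

lemma HN_phase_less: "\<lbrakk>HN_data D P E n \<phi> Es A; 1 \<le> j; j < k; k \<le> n\<rbrakk> \<Longrightarrow> \<phi> k < \<phi> j"
  unfolding HN_data_def by auto

lemma HN_phase_bounds:
  assumes HN: "HN_data D P E n \<phi> Es A" and k: "k \<in> {1..n}"
  shows "\<phi> n \<le> \<phi> k" "\<phi> k \<le> \<phi> 1"
  using HN_phase_less[OF HN, of k n] HN_phase_less[OF HN, of 1 k] k
  by (cases "k = n"; cases "k = 1"; force)+

lemma HN_step_Ob: "HN_data D P E n \<phi> Es A \<Longrightarrow> k \<le> n \<Longrightarrow> Es k \<in> Ob D"
proof (cases "k = 0")
  case True
  then show "HN_data D P E n \<phi> Es A \<Longrightarrow> ?thesis" by (auto simp: HN_data_def zero_ob_def)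
next
  case False
  assume "HN_data D P E n \<phi> Es A" "k \<le> n"
  with False obtain f g h where "triangle D (Es (k - 1)) (Es k) (A k) f g h"
    using HN_triangle[of E n \<phi> Es A k] by (auto simp: Suc_le_eq)
  then show ?thesis using triangle_Ob by blast
qed

lemma HN_hom_zero_to:
  assumes HN: "HN_data D P E n \<phi> Es A" and "\<And>i. i \<in> {1..k} \<Longrightarrow> hom_zero D T (A i)"
  shows "k \<le> n \<Longrightarrow> hom_zero D T (Es k)"
  using assms(2)
proof (induction k)
  case 0
  then show ?case using HN hom_zero_to_zero_ob by (simp add: HN_data_def)
next
  case (Suc k)
  then obtain f g h where "triangle D (Es k) (Es (Suc k)) (A (Suc k)) f g h"
    using HN_triangle_Suc[OF HN, of k] by (auto simp: Suc_le_eq)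
  then show ?case using hom_zero_middle_to Suc by auto
qed

lemma HN_hom_zero_from:
  assumes HN: "HN_data D P E n \<phi> Es A" and "\<And>i. i \<in> {1..k} \<Longrightarrow> hom_zero D (A i) T"
  shows "k \<le> n \<Longrightarrow> hom_zero D (Es k) T"
  using assms(2)
proof (induction k)
  case 0
  then show ?case using HN hom_zero_from_zero_ob by (simp add: HN_data_def)
next
  case (Suc k)
  then obtain f g h where "triangle D (Es k) (Es (Suc k)) (A (Suc k)) f g h"
    using HN_triangle_Suc[OF HN, of k] by (auto simp: Suc_le_eq)
  then show ?case using hom_zero_middle_from Suc by auto
qed

text \<open>Downward along the filtration: what could obstruct the passage from step
  \<open>k + 1\<close> to step \<open>k\<close> is a map from \<open>shO D T\<close> to the factor
  between them.\<close>

lemma HN_hom_zero_back: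
  assumes HN: "HN_data D P E n \<phi> Es A" and T: "T \<in> Ob D" "hom_zero D T E"
    and shT: "\<And>i. j < i \<Longrightarrow> i \<le> n \<Longrightarrow> hom_zero D (shO D T) (A i)"
    and "j \<le> n"
  shows "hom_zero D T (Es j)"
  using \<open>j \<le> n\<close> shT
proof (induction rule: inc_induct)
  case base
  then show ?case using T HN by (simp add: HN_data_def)
next
  case (step k)
  then obtain f g h where "triangle D (Es k) (Es (Suc k)) (A (Suc k)) f g h"
    using HN_triangle_Suc[OF HN, of k] by (auto simp: Suc_le_eq)
  then show ?case using hom_zero_first_to[OF _ T(1)] step by auto
qed

text \<open>Read contrapositively: a nonzero map to the first factor yields a nonzero map to
  \<open>E\<close>. No phase of \<open>T\<close> enters, so \<open>T\<close> may be taken from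
  another slicing.\<close>

lemma HN_hom_zero_first_factor:
  assumes HN: "HN_data D P E n \<phi> Es A" and T: "T \<in> Ob D" "hom_zero D T E"
    and shT: "\<And>i. 1 < i \<Longrightarrow> i \<le> n \<Longrightarrow> hom_zero D (shO D T) (A i)"
    and "1 \<le> n"
  shows "hom_zero D T (A 1)"
proof -
  obtain f g h where t: "triangle D (Es 0) (Es 1) (A 1) f g h"
    using HN_triangle_Suc[OF HN, of 0] \<open>1 \<le> n\<close> by auto
  have "hom_zero D T (shO D (Es 0))"
    using hom_zero_to_zero_ob zero_ob_shift HN by (simp add: HN_data_def)
  then show ?thesis
    using hom_zero_cone_to[OF t] HN_hom_zero_back[OF HN T, of 1] shT \<open>1 \<le> n\<close> by blast
qed

lemma HN_hom_zero_last_factor: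
  assumes HN: "HN_data D P E n \<phi> Es A" and T: "hom_zero D E T"
    and sh: "hom_zero D (shO D (Es (n - 1))) T" and "1 \<le> n"
  shows "hom_zero D (A n) T"
proof -
  obtain f g h where "triangle D (Es (n - 1)) (Es n) (A n) f g h"
    using HN_triangle[OF HN \<open>1 \<le> n\<close>] by blast
  then show ?thesis using hom_zero_cone_from T sh HN by (simp add: HN_data_def)
qed

lemma HN_hom_zero_above:
  assumes HN: "HN_data D P E n \<phi> Es A" and "T \<in> P \<psi>" "\<phi> 1 < \<psi>"
  shows "hom_zero D T E"
proof -
  have "hom_zero D T (A i)" if "i \<in> {1..n}" for i
    using slice_hom_zero[OF assms(2)] HN_factor[OF HN that] HN_phase_less[OF HN, of 1 i] that assms(3)
    by (cases "i = 1") force+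
  then show ?thesis using HN_hom_zero_to[OF HN, of n] HN by (simp add: HN_data_def)
qed

lemma HN_hom_zero_below:
  assumes HN: "HN_data D P E n \<phi> Es A" and "T \<in> P \<psi>" "\<psi> < \<phi> n"
  shows "hom_zero D E T"
proof -
  have "hom_zero D (A i) T" if "i \<in> {1..n}" for i
    using slice_hom_zero[OF _ assms(2)] HN_factor[OF HN that] HN_phase_less[OF HN, of i n] that assms(3)
    by (cases "i = n") force+
  then show ?thesis using HN_hom_zero_from[OF HN, of n] HN by (simp add: HN_data_def)
qed

text \<open>\<open>shO D (A 1)\<close> has phase \<open>\<phi> 1 + 1\<close>, above all factors, so
  if \<open>A 1\<close> had no nonzero map to \<open>E\<close>, its own identity would
  vanish.\<close>

lemma HN_first_factor_not_hom_zero: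
  assumes HN: "HN_data D P E n \<phi> Es A" and "1 \<le> n"
  shows "\<not> hom_zero D (A 1) E"
proof
  assume hz: "hom_zero D (A 1) E"
  have A1: "A 1 \<in> P (\<phi> 1)" "A 1 \<in> nonzero_obs D" using HN_factor[OF HN] assms(2) by auto
  have "hom_zero D (shO D (A 1)) (A i)" if "1 < i" "i \<le> n" for i
    using slice_hom_zero[OF slice_shift[OF A1(1)]] HN_factor[OF HN, of i] HN_phase_less[OF HN, of 1 i] that
    by force
  then show False
    using HN_hom_zero_first_factor[OF HN slice_Ob[OF A1(1)] hz] nonzero_not_hom_zero[OF A1(2)] assms(2)
    by blast
qed

lemma HN_last_factor_not_hom_zero:
  assumes HN: "HN_data D P E n \<phi> Es A" and "1 \<le> n"
  shows "\<not> hom_zero D E (A n)"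
proof
  assume hz: "hom_zero D E (A n)"
  have An: "A n \<in> P (\<phi> n)" "A n \<in> nonzero_obs D" using HN_factor[OF HN] assms(2) by auto
  have "hom_zero D (shO D (Es (n - 1))) (A n)"
  proof (rule hom_zero_shift_slice[OF _ An(1)])
    show "Es (n - 1) \<in> Ob D" using HN_step_Ob[OF HN] by simp
    fix T' assume T': "T' \<in> P (\<phi> n - 1)"
    have "hom_zero D (A i) T'" if "i \<in> {1..n - 1}" for i
      using slice_hom_zero[OF _ T'] HN_factor[OF HN, of i] HN_phase_less[OF HN, of i n] that by force
    then show "hom_zero D (Es (n - 1)) T'" using HN_hom_zero_from[OF HN, of "n - 1"] by simp
  qed
  then show False
    using HN_hom_zero_last_factor[OF HN hz] nonzero_not_hom_zero[OF An(2)] assms(2) by blast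
qed

text \<open>The extreme phases are the largest \<open>\<psi>\<close> with a nonzero map
  from \<open>P \<psi>\<close> to \<open>E\<close> and the smallest \<open>\<psi>\<close> with a nonzero map from \<open>E\<close> to
  \<open>P \<psi>\<close>, hence independent of the filtration.\<close>

lemma phi_plus_eq:
  assumes HN: "HN_data D P E n \<phi> Es A" and E: "E \<in> nonzero_obs D"
  shows "phi_plus D P E = \<phi> 1"
  unfolding phi_plus_def
proof (rule the_equality)
  show "\<exists>n \<phi>'. HN_filtration D P E n \<phi>' \<and> \<phi> 1 = \<phi>' 1"
    using HN_filtration_iff_data[of D P E n \<phi>] HN by metis
  fix x assume "\<exists>n \<phi>. HN_filtration D P E n \<phi> \<and> x = \<phi> 1"
  then obtain m \<psi> where "HN_filtration D P E m \<psi>" and x: "x = \<psi> 1" by metis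
  then obtain Fs B where HN': "HN_data D P E m \<psi> Fs B"
    unfolding HN_filtration_iff_data by metis
  note n = HN_length_pos[OF HN E] and m = HN_length_pos[OF HN' E]
  have "A 1 \<in> P (\<phi> 1)" "B 1 \<in> P (\<psi> 1)" using HN_factor[OF HN, of 1] HN_factor[OF HN', of 1] n m by auto
  then show "x = \<phi> 1"
    using HN_hom_zero_above[OF HN] HN_hom_zero_above[OF HN']
      HN_first_factor_not_hom_zero[OF HN n] HN_first_factor_not_hom_zero[OF HN' m] x
    by (metis linorder_neqE_linordered_idom)
qed

lemma phi_minus_eq:
  assumes HN: "HN_data D P E n \<phi> Es A" and E: "E \<in> nonzero_obs D"
  shows "phi_minus D P E = \<phi> n"
  unfolding phi_minus_def
proof (rule the_equality)
  show "\<exists>m \<phi>'. HN_filtration D P E m \<phi>' \<and> \<phi> n = \<phi>' m"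
    using HN_filtration_iff_data[of D P E n \<phi>] HN by metis
  fix x assume "\<exists>n \<phi>. HN_filtration D P E n \<phi> \<and> x = \<phi> n"
  then obtain m \<psi> where "HN_filtration D P E m \<psi>" and x: "x = \<psi> m" by metis
  then obtain Fs B where HN': "HN_data D P E m \<psi> Fs B"
    unfolding HN_filtration_iff_data by metis
  note n = HN_length_pos[OF HN E] and m = HN_length_pos[OF HN' E]
  have "A n \<in> P (\<phi> n)" "B m \<in> P (\<psi> m)" using HN_factor[OF HN, of n] HN_factor[OF HN', of m] n m by auto
  then show "x = \<phi> n"
    using HN_hom_zero_below[OF HN] HN_hom_zero_below[OF HN']
      HN_last_factor_not_hom_zero[OF HN n] HN_last_factor_not_hom_zero[OF HN' m] x
    by (metis linorder_neqE_linordered_idom)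
qed

lemma HN_exists:
  assumes "E \<in> nonzero_obs D"
  obtains n \<phi> Es A where "HN_data D P E n \<phi> Es A" "1 \<le> n"
    "phi_plus D P E = \<phi> 1" "phi_minus D P E = \<phi> n"
proof -
  obtain n \<phi> where "HN_filtration D P E n \<phi>"
    using slicing assms unfolding slicing_def by blast
  then show thesis
    using that HN_filtration_iff_data phi_plus_eq phi_minus_eq HN_length_pos assms by metis
qed

lemma phi_minus_le_phi_plus:
  assumes E: "E \<in> nonzero_obs D"
  shows "phi_minus D P E \<le> phi_plus D P E"
proof -
  obtain n \<phi> Es A where HN: "HN_data D P E n \<phi> Es A" "1 \<le> n"
      "phi_plus D P E = \<phi> 1" "phi_minus D P E = \<phi> n"
    by (rule HN_exists[OF E])
  then show ?thesis using HN_phase_bounds[OF HN(1), of n] by simp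
qed

lemma hom_zero_above_phi_plus:
  "\<lbrakk>E \<in> nonzero_obs D; T \<in> P \<psi>; phi_plus D P E < \<psi>\<rbrakk> \<Longrightarrow> hom_zero D T E"
  by (metis HN_exists HN_hom_zero_above)

lemma hom_zero_below_phi_minus:
  "\<lbrakk>E \<in> nonzero_obs D; T \<in> P \<psi>; \<psi> < phi_minus D P E\<rbrakk> \<Longrightarrow> hom_zero D E T"
  by (metis HN_exists HN_hom_zero_below)

lemma phi_plus_attained:
  assumes "E \<in> nonzero_obs D"
  obtains T where "T \<in> P (phi_plus D P E)" "\<not> hom_zero D T E"
proof -
  obtain n \<phi> Es A where HN: "HN_data D P E n \<phi> Es A" "1 \<le> n" "phi_plus D P E = \<phi> 1"
    by (rule HN_exists[OF assms])
  then show thesis using that HN_factor[OF HN(1), of 1] HN_first_factor_not_hom_zero[OF HN(1,2)] by auto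
qed

lemma phi_minus_attained:
  assumes "E \<in> nonzero_obs D"
  obtains T where "T \<in> P (phi_minus D P E)" "\<not> hom_zero D E T"
proof -
  obtain n \<phi> Es A where HN: "HN_data D P E n \<phi> Es A" "1 \<le> n" "phi_minus D P E = \<phi> n"
    by (rule HN_exists[OF assms])
  then show thesis using that HN_factor[OF HN(1), of n] HN_last_factor_not_hom_zero[OF HN(1,2)] by auto
qed

lemma HN_data_semistable:
  assumes E: "E \<in> P \<phi>" "E \<in> nonzero_obs D" and N: "zero_ob D N"
  shows "HN_data D P E 1 (\<lambda>_. \<phi>) (\<lambda>k. if k = 0 then N else E) (\<lambda>_. E)"
  unfolding HN_data_def using assms triangle_zero_idn[OF slice_Ob[OF E(1)] N] by auto

lemma semistable_phases:
  assumes "E \<in> P \<phi>" "E \<in> nonzero_obs D"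
  shows "phi_plus D P E = \<phi>" "phi_minus D P E = \<phi>"
proof -
  obtain N where "zero_ob D N" using ex_zero_ob by blast
  from HN_data_semistable[OF assms this]
  show "phi_plus D P E = \<phi>" "phi_minus D P E = \<phi>"
    using phi_plus_eq phi_minus_eq assms(2) by blast+
qed

lemma semistable_if_phases_const:
  assumes E: "E \<in> nonzero_obs D" and "phi_plus D P E = \<phi>" "phi_minus D P E = \<phi>"
  shows "E \<in> P \<phi>"
proof -
  obtain n \<psi> Es A where HN: "HN_data D P E n \<psi> Es A" "1 \<le> n"
      "phi_plus D P E = \<psi> 1" "phi_minus D P E = \<psi> n"
    by (rule HN_exists[OF E])
  then have "n = 1" using assms HN_phase_less[OF HN(1), of 1 n] by force
  obtain f g h where "triangle D (Es 0) (Es 1) (A 1) f g h"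
    using HN_triangle_Suc[OF HN(1), of 0] HN(2) by auto
  then have "isomorphic D (A 1) E"
    using triangle_zero_first_iso isomorphic_sym HN(1) \<open>n = 1\<close> by (auto simp: HN_data_def)
  then show ?thesis
    using slice_iso[of "A 1"] HN_factor[OF HN(1), of 1] HN(2,3) assms(2) E by (auto simp: nonzero_obs_def)
qed

end

text \<open>If two slicings are close, the first Harder--Narasimhan factor \<open>F\<close> of \<open>E\<close> for
  the first one still detects the largest phase for the second one: a nonzero map \<open>T \<rightarrow> F\<close>
  cannot become zero in \<open>E\<close>, because \<open>Hom(T[1], A) = 0\<close> for all lower factors \<open>A\<close>.\<close>

lemma phi_plus_first_factor_le:
  assumes "sliced_category D P" "sliced_category D Q" and E: "E \<in> nonzero_obs D"
    and near: "\<And>F. F \<in> nonzero_obs D \<Longrightarrow> \<bar>phi_plus D P F - phi_plus D Q F\<bar> < 1/2"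
    and HN: "HN_data D P E n \<phi> Es A" and n: "1 \<le> n"
  shows "phi_plus D Q (A 1) \<le> phi_plus D Q E"
proof (rule ccontr)
  interpret P: sliced_category D P by fact
  interpret Q: sliced_category D Q by fact
  have A: "A i \<in> nonzero_obs D" "phi_plus D P (A i) = \<phi> i" if "1 \<le> i" "i \<le> n" for i
    using P.HN_factor[OF HN, of i] P.semistable_phases that by auto
  obtain T where T: "T \<in> Q (phi_plus D Q (A 1))" "\<not> hom_zero D T (A 1)"
    using Q.phi_plus_attained[OF A(1)] n by blast
  assume "\<not> ?thesis"
  then have "hom_zero D T E" using Q.hom_zero_above_phi_plus[OF E T(1)] by simp
  \<comment> \<open>The shift raises the phase by 1, while changing the slicing costs less than
    \<open>1/2\<close> for \<open>A 1\<close> and less than \<open>1/2\<close> for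
    \<open>A i\<close>; so \<open>shO D T\<close> stays above the \<open>Q\<close>-phases of
    \<open>A i\<close>.\<close>
  moreover have "hom_zero D (shO D T) (A i)" if "1 < i" "i \<le> n" for i
    using Q.hom_zero_above_phi_plus[OF A(1) Q.slice_shift[OF T(1)], of i]
      near[OF A(1), of i] near[OF A(1), of 1] A(2)[of i] A(2)[of 1] P.HN_phase_less[OF HN, of 1 i] that
    by fastforce
  ultimately show False
    using P.HN_hom_zero_first_factor[OF HN Q.slice_Ob[OF T(1)]] n T(2) by blast
qed

text \<open>Dually, a nonzero map from the last factor to \<open>T\<close> yields one from
  \<open>E\<close>: after unshifting, the target has a phase lower by 1, which is below all
  \<open>Q\<close>-phases of the earlier factors.\<close>

lemma phi_minus_last_factor_ge:
  assumes "sliced_category D P" "sliced_category D Q" and E: "E \<in> nonzero_obs D"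
    and near: "\<And>F. F \<in> nonzero_obs D \<Longrightarrow> \<bar>phi_minus D P F - phi_minus D Q F\<bar> < 1/2"
    and HN: "HN_data D P E n \<phi> Es A" and n: "1 \<le> n"
  shows "phi_minus D Q E \<le> phi_minus D Q (A n)"
proof (rule ccontr)
  interpret P: sliced_category D P by fact
  interpret Q: sliced_category D Q by fact
  have A: "A i \<in> nonzero_obs D" "phi_minus D P (A i) = \<phi> i" if "1 \<le> i" "i \<le> n" for i
    using P.HN_factor[OF HN, of i] P.semistable_phases that by auto
  obtain T where T: "T \<in> Q (phi_minus D Q (A n))" "\<not> hom_zero D (A n) T"
    using Q.phi_minus_attained[OF A(1)] n by blast
  assume "\<not> ?thesis"
  then have "hom_zero D E T" using Q.hom_zero_below_phi_minus[OF E T(1)] by simp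
  moreover have "hom_zero D (shO D (Es (n - 1))) T"
  proof (rule Q.hom_zero_shift_slice[OF _ T(1)])
    show "Es (n - 1) \<in> Ob D" using P.HN_step_Ob[OF HN] by simp
    fix T' assume T': "T' \<in> Q (phi_minus D Q (A n) - 1)"
    have "hom_zero D (A i) T'" if "i \<in> {1..n - 1}" for i
      using Q.hom_zero_below_phi_minus[OF A(1) T', of i]
        near[OF A(1), of i] near[OF A(1), of n] A(2)[of i] A(2)[of n] P.HN_phase_less[OF HN, of i n]
        that n by fastforce
    then show "hom_zero D (Es (n - 1)) T'" using P.HN_hom_zero_from[OF HN, of "n - 1"] by simp
  qed
  ultimately show False
    using P.HN_hom_zero_last_factor[OF HN] n T(2) by blast
qed

section \<open>Discreteness of the charge\<close>

text \<open>On the compact unit sphere of coefficient vectors in the maximum norm, the norm of the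
  combination is continuous and, by independence, nonzero. Its minimum there is \<open>c\<close>,
  and homogeneity does the rest.\<close>

lemma independent_coefficient_bound:
  fixes b :: "nat \<Rightarrow> 'v::real_normed_vector"
  assumes inj: "inj_on b {..<n}" and indep: "independent (b ` {..<n})"
  obtains c where "c > 0" "\<And>a i. i < n \<Longrightarrow> c * \<bar>a i\<bar> \<le> norm (\<Sum>j<n. a j *\<^sub>R b j)"
proof -
  define f where "f a = norm (\<Sum>j<n. a j *\<^sub>R b j)" for a :: "nat \<Rightarrow> real"
  \<comment> \<open>Coefficient vectors are functions on all naturals; pinning the entries from
    \<open>n\<close> on to 0 makes the cube a product of compact sets.\<close>
  define K where "K = (\<Pi>\<^sub>E i\<in>UNIV. if i < n then {-1..1} else {0::real})"
  define S where "S = K \<inter> (\<Union>j<n. {a. \<bar>a j\<bar> = 1})"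
  have coeff_zero: "a i = 0" if "f a = 0" "i < n" for a i
  proof -
    have "(\<Sum>v\<in>b ` {..<n}. a (inv_into {..<n} b v) *\<^sub>R v) = (\<Sum>j<n. a j *\<^sub>R b j)"
      using inj by (simp add: sum.reindex)
    then have "a (inv_into {..<n} b (b i)) = 0"
      using that independentD[OF indep, of "b ` {..<n}" "\<lambda>v. a (inv_into {..<n} b v)" "b i"]
      by (simp add: f_def)
    then show ?thesis using inj that by simp
  qed
  have "compactin (product_topology (\<lambda>i::nat. euclidean) UNIV) K"
    unfolding K_def compactin_PiE by (auto simp: compactin_euclidean_iff)
  then have "compact K" by (simp add: euclidean_product_topology compactin_euclidean_iff)
  moreover have "closed (\<Union>j<n. {a::nat \<Rightarrow> real. \<bar>a j\<bar> = 1})"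
  proof (intro closed_UN ballI)
    fix j :: nat
    have "continuous_on UNIV (\<lambda>a::nat \<Rightarrow> real. \<bar>a j\<bar>)"
      by (intro continuous_intros continuous_on_product_coordinates)
    then show "closed {a::nat \<Rightarrow> real. \<bar>a j\<bar> = 1}"
      by (intro closed_Collect_eq continuous_on_const)
  qed simp
  ultimately have S: "compact S" unfolding S_def by (rule compact_Int_closed)
  have f_cont: "continuous_on S f"
    unfolding f_def
    by (intro continuous_intros continuous_on_subset[OF continuous_on_product_coordinates]) auto
  obtain c where c: "c > 0" "\<And>a. a \<in> S \<Longrightarrow> c \<le> f a"
  proof (cases "S = {}")
    case True
    \<comment> \<open>The sphere is empty only for \<open>n = 0\<close>, where any constant
      serves.\<close>
    then show thesis using that[of 1] by simp
  next
    case False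
    from continuous_attains_inf[OF S False f_cont] obtain a0 where a0: "a0 \<in> S" "\<forall>a\<in>S. f a0 \<le> f a"
      by blast
    have "f a0 \<noteq> 0" using coeff_zero[of a0] a0(1) by (auto simp: S_def)
    then have "f a0 > 0" by (simp add: f_def)
    then show thesis using that a0(2) by blast
  qed
  have "c * \<bar>a i\<bar> \<le> f a" if "i < n" for a i
  proof -
    define m where "m = (MAX j\<in>{..<n}. \<bar>a j\<bar>)"
    have le: "\<bar>a j\<bar> \<le> m" if "j < n" for j unfolding m_def using that by (intro Max_ge) auto
    have "m \<in> (\<lambda>j. \<bar>a j\<bar>) ` {..<n}" unfolding m_def using \<open>i < n\<close> by (intro Max_in) auto
    then obtain j where j: "j < n" "m = \<bar>a j\<bar>" by auto
    show ?thesis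
    proof (cases "m = 0")
      case True
      then show ?thesis using le[OF that] by (simp add: f_def)
    next
      case False
      then have "m > 0" using j by simp
      define a' where "a' k = (if k < n then a k / m else 0)" for k
      have "\<bar>a' k\<bar> \<le> 1" for k using le[of k] \<open>m > 0\<close> by (simp add: a'_def)
      moreover have "\<bar>a' j\<bar> = 1" using j \<open>m > 0\<close> by (simp add: a'_def)
      ultimately have "a' \<in> S"
        using j(1) by (auto simp: S_def K_def abs_le_iff minus_le_iff) (simp add: a'_def)
      moreover have "f a' = f a / m"
      proof -
        have "(\<Sum>j<n. a' j *\<^sub>R b j) = (1 / m) *\<^sub>R (\<Sum>j<n. a j *\<^sub>R b j)"
          unfolding scaleR_sum_right by (intro sum.cong) (auto simp: a'_def)
        then show ?thesis using \<open>m > 0\<close> by (simp add: f_def)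
      qed
      ultimately have "c * m \<le> f a" using c(2)[of a'] \<open>m > 0\<close>
        by (simp add: le_divide_eq)
      then show ?thesis using le[OF that] c(1) by (smt (verit) mult_left_mono)
    qed
  qed
  then show thesis using that c(1) by (auto simp: f_def)
qed

lemma finite_bounded_integer_vectors:
  "finite {x :: nat \<Rightarrow>\<^sub>0 int. Poly_Mapping.keys x \<subseteq> {..<n} \<and> (\<forall>i<n. \<bar>Poly_Mapping.lookup x i\<bar> \<le> B)}"
  (is "finite ?X")
proof (rule inj_on_finite)
  show "inj_on (\<lambda>x. restrict (Poly_Mapping.lookup x) {..<n}) ?X"
  proof (rule inj_onI)
    fix x y assume x: "x \<in> ?X" and y: "y \<in> ?X"
      and eq: "restrict (Poly_Mapping.lookup x) {..<n} = restrict (Poly_Mapping.lookup y) {..<n}"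
    have "Poly_Mapping.lookup x i = Poly_Mapping.lookup y i" for i
    proof (cases "i < n")
      case True
      then show ?thesis using fun_cong[OF eq, of i] by simp
    next
      case False
      then have "i \<notin> Poly_Mapping.keys x" "i \<notin> Poly_Mapping.keys y" using x y by auto
      then show ?thesis by (simp add: in_keys_iff)
    qed
    then show "x = y" by (rule poly_mapping_eqI)
  qed
  show "(\<lambda>x. restrict (Poly_Mapping.lookup x) {..<n}) ` ?X \<subseteq> ({..<n} \<rightarrow>\<^sub>E {-B..B})"
    by (auto simp: abs_le_iff PiE_iff) (metis minus_le_iff)+
  show "finite ({..<n} \<rightarrow>\<^sub>E {-B..B})" by (intro finite_PiE) auto
qed

text \<open>An integral basis of \<open>\<Gamma>\<close> is independent over the reals, so a bound
  on the norm bounds the integer coordinates.\<close>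

lemma finite_lattice_ball:
  fixes \<iota> :: "'g \<Rightarrow> 'v::real_normed_vector"
  assumes "realification \<Gamma> \<iota>"
  shows "finite {\<gamma> \<in> carrier \<Gamma>. norm (\<iota> \<gamma>) \<le> R}"
proof -
  obtain n b where \<iota>: "\<iota> \<in> hom \<Gamma> additive_group" and b: "b \<in> iso (free_Abelian_group {..<n::nat}) \<Gamma>"
    and inj: "inj_on (\<lambda>i. \<iota> (b (frag_of i))) {..<n}"
    and indep: "independent ((\<lambda>i. \<iota> (b (frag_of i))) ` {..<n})"
    using assms unfolding realification_def by blast
  obtain c where c: "c > 0"
    "\<And>a i. i < n \<Longrightarrow> c * \<bar>a i\<bar> \<le> norm (\<Sum>j<n. a j *\<^sub>R \<iota> (b (frag_of j)))"
    using independent_coefficient_bound[OF inj indep] by blast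
  define h where "h x = \<iota> (b x)" for x
  have h_add: "h (x + y) = h x + h y"
    if "Poly_Mapping.keys x \<subseteq> {..<n}" "Poly_Mapping.keys y \<subseteq> {..<n}" for x y
  proof -
    have xy: "x \<in> carrier (free_Abelian_group {..<n})" "y \<in> carrier (free_Abelian_group {..<n})"
      using that by simp_all
    have "b (x + y) = b x \<otimes>\<^bsub>\<Gamma>\<^esub> b y" "b x \<in> carrier \<Gamma>" "b y \<in> carrier \<Gamma>"
      using b xy hom_mult[of b "free_Abelian_group {..<n}" \<Gamma> x y]
        hom_in_carrier[of b "free_Abelian_group {..<n}" \<Gamma>] by (simp_all add: iso_def)
    then show ?thesis
      using hom_mult[OF \<iota>, of "b x" "b y"] by (simp add: h_def additive_group_def)
  qed
  \<comment> \<open>The induction principle for free abelian groups builds elements by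
    differences.\<close>
  have h_diff: "h (x - y) = h x - h y"
    if "Poly_Mapping.keys x \<subseteq> {..<n}" "Poly_Mapping.keys y \<subseteq> {..<n}" for x y
    using h_add[of "x - y" y] that order_trans[OF keys_diff[of x y]] by (simp add: algebra_simps)
  have h_eq: "h x = (\<Sum>j<n. of_int (Poly_Mapping.lookup x j) *\<^sub>R \<iota> (b (frag_of j)))"
    if "Poly_Mapping.keys x \<subseteq> {..<n}" for x
    using that
  proof (induction x rule: free_Abelian_group_induct[consumes 1])
    case 1
    then show ?case using h_diff[of 0 0] by simp
  next
    case (2 x y)
    then show ?case by (simp add: h_diff lookup_minus sum_subtractf scaleR_diff_left)
  next
    case (3 a)
    then have "(\<Sum>j<n. of_int (Poly_Mapping.lookup (frag_of a) j) *\<^sub>R \<iota> (b (frag_of j)))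
        = (\<Sum>j\<in>{a}. \<iota> (b (frag_of j)))"
      by (intro sum.mono_neutral_cong_right) auto
    then show ?case by (simp add: h_def)
  qed
  define B where "B = \<lceil>R / c\<rceil>"
  have "{\<gamma> \<in> carrier \<Gamma>. norm (\<iota> \<gamma>) \<le> R} \<subseteq>
      b ` {x. Poly_Mapping.keys x \<subseteq> {..<n} \<and> (\<forall>i<n. \<bar>Poly_Mapping.lookup x i\<bar> \<le> B)}"
  proof
    fix \<gamma> assume \<gamma>: "\<gamma> \<in> {\<gamma> \<in> carrier \<Gamma>. norm (\<iota> \<gamma>) \<le> R}"
    then have "\<gamma> \<in> b ` carrier (free_Abelian_group {..<n})"
      using b unfolding iso_def bij_betw_def by auto
    then obtain x where x: "Poly_Mapping.keys x \<subseteq> {..<n}" "\<gamma> = b x" by auto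
    have "\<bar>Poly_Mapping.lookup x i\<bar> \<le> B" if "i < n" for i
    proof -
      have "c * \<bar>of_int (Poly_Mapping.lookup x i)\<bar> \<le> R"
        using c(2)[OF that, of "\<lambda>i. of_int (Poly_Mapping.lookup x i)"] h_eq[OF x(1)] \<gamma> x(2)
        by (simp add: h_def)
      then have "real_of_int \<bar>Poly_Mapping.lookup x i\<bar> \<le> R / c"
        using c(1) by (simp add: field_simps)
      then show ?thesis unfolding B_def by linarith
    qed
    then show "\<gamma> \<in> b ` {x. Poly_Mapping.keys x \<subseteq> {..<n} \<and> (\<forall>i<n. \<bar>Poly_Mapping.lookup x i\<bar> \<le> B)}"
      using x by blast
  qed
  then show ?thesis using finite_bounded_integer_vectors finite_surj by blast
qed

section \<open>Additivity of classes and charges along triangles\<close>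

lemma (in triangulated_category) K_class_triangle:
  assumes "triangle D X Y C f g h"
  shows "K_class D Y = K_class D X \<otimes>\<^bsub>K_group D\<^esub> K_class D C"
proof -
  interpret F: comm_group "free_Abelian_group (Ob D)" by (rule abelian_free_Abelian_group)
  let ?R = "{frag_of (tgt D f) - frag_of (src D f) - frag_of (tgt D g) | f g h. (f, g, h) \<in> dist_tri D}"
  have Ob: "X \<in> Ob D" "Y \<in> Ob D" "C \<in> Ob D" using triangle_Ob[OF assms] by auto
  have "?R \<subseteq> carrier (free_Abelian_group (Ob D))"
  proof
    fix x assume "x \<in> ?R"
    then obtain f g h where t: "(f, g, h) \<in> dist_tri D"
      and x: "x = frag_of (tgt D f) - frag_of (src D f) - frag_of (tgt D g)" by blast
    obtain X Y C where "f \<in> Hom D X Y" "g \<in> Hom D Y C" using dist_tri_Hom[OF t] by blast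
    then have "tgt D f \<in> Ob D" "src D f \<in> Ob D" "tgt D g \<in> Ob D" using Hom_Ob by (auto simp: Hom_def)
    then show "x \<in> carrier (free_Abelian_group (Ob D))"
      using keys_diff[of "frag_of (tgt D f) - frag_of (src D f)" "frag_of (tgt D g)"]
        keys_diff[of "frag_of (tgt D f)" "frag_of (src D f)"]
      by (auto simp: x)
  qed
  then have sub: "subgroup (K_relations D) (free_Abelian_group (Ob D))"
    unfolding K_relations_def by (rule F.generate_is_subgroup)
  then have normal: "K_relations D \<lhd> free_Abelian_group (Ob D)" by (rule F.subgroup_imp_normal)
  have fgh: "src D f = X" "tgt D f = Y" "tgt D g = C" "(f, g, h) \<in> dist_tri D"
    using assms by (auto simp: triangle_def Hom_def)
  have "frag_of (tgt D f) - frag_of (src D f) - frag_of (tgt D g) \<in> ?R" using fgh(4) by blast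
  then have "frag_of Y - frag_of X - frag_of C \<in> K_relations D"
    unfolding K_relations_def fgh by (rule generate.incl)
  then have "frag_of Y \<in> K_relations D #>\<^bsub>free_Abelian_group (Ob D)\<^esub> (frag_of X + frag_of C)"
    unfolding r_coset_def by (rule UN_I) simp
  moreover have "frag_of X + frag_of C \<in> carrier (free_Abelian_group (Ob D))"
    using Ob F.m_closed[of "frag_of X" "frag_of C"] by simp
  ultimately have "K_class D Y = K_relations D #>\<^bsub>free_Abelian_group (Ob D)\<^esub> (frag_of X + frag_of C)"
    unfolding K_class_def using F.repr_independence sub by blast
  then show ?thesis
    using normal.rcos_sum[OF normal, of "frag_of X" "frag_of C"] Ob
    by (simp add: K_class_def K_group_def FactGroup_def)
qed

lemma K_class_carrier: "E \<in> Ob D \<Longrightarrow> K_class D E \<in> carrier (K_group D)"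
proof -
  assume "E \<in> Ob D"
  then have "K_class D E \<in> rcosets\<^bsub>free_Abelian_group (Ob D)\<^esub> K_relations D"
    unfolding K_class_def RCOSETS_def by (intro UN_I[of "frag_of E"]) simp_all
  then show ?thesis by (simp add: K_group_def FactGroup_def)
qed

lemma (in triangulated_category) charge_triangle:
  assumes cl: "cl \<in> hom (K_group D) \<Gamma>" and Z: "Z \<in> hom \<Gamma> additive_group"
    and t: "triangle D X Y C f g h"
  shows "Z (cl (K_class D Y)) = Z (cl (K_class D X)) + Z (cl (K_class D C))"
proof -
  have Ob: "X \<in> Ob D" "C \<in> Ob D" using triangle_Ob[OF t] by auto
  note K = K_class_carrier[OF Ob(1)] K_class_carrier[OF Ob(2)]
  have "cl (K_class D Y) = cl (K_class D X) \<otimes>\<^bsub>\<Gamma>\<^esub> cl (K_class D C)"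
    using hom_mult[OF cl K] K_class_triangle[OF t] by metis
  moreover have "Z (cl (K_class D X) \<otimes>\<^bsub>\<Gamma>\<^esub> cl (K_class D C))
      = Z (cl (K_class D X)) \<otimes>\<^bsub>additive_group\<^esub> Z (cl (K_class D C))"
    using hom_mult[OF Z hom_in_carrier[OF cl K(1)] hom_in_carrier[OF cl K(2)]] .
  ultimately show ?thesis
    by (simp add: additive_group_def)
qed

section \<open>Central charges on a slicing\<close>

text \<open>\<open>W E\<close> is the central charge of the class of \<open>E\<close>.\<close>

locale charged_slicing = sliced_category D P
  for D :: "('o, 'm, 'z) tri_data_scheme" and P :: "real \<Rightarrow> 'o set" +
  fixes W :: "'o \<Rightarrow> complex"
  assumes W_triangle: "triangle D X Y C f g h \<Longrightarrow> W Y = W X + W C"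
    and W_semistable: "\<lbrakk>E \<in> P \<phi>; E \<in> nonzero_obs D\<rbrakk> \<Longrightarrow> \<exists>r>0. W E = of_real r * cis (pi * \<phi>)"
begin

lemma W_zero_ob: "zero_ob D N \<Longrightarrow> W N = 0"
  using W_triangle[OF triangle_idn_zero[of N N]] zero_ob_Ob by auto

lemma W_HN:
  assumes HN: "HN_data D P E n \<phi> Es A"
  shows "W E = (\<Sum>k=1..n. W (A k))"
proof -
  have "k \<le> n \<Longrightarrow> W (Es k) = (\<Sum>i=1..k. W (A i))" for k
  proof (induction k)
    case 0
    then show ?case using HN W_zero_ob by (simp add: HN_data_def)
  next
    case (Suc k)
    then obtain f g h where "triangle D (Es k) (Es (Suc k)) (A (Suc k)) f g h"
      using HN_triangle_Suc[OF HN, of k] by (auto simp: Suc_le_eq)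
    then show ?case using W_triangle Suc by simp
  qed
  from this[of n] show ?thesis using HN by (auto simp: HN_data_def)
qed

text \<open>The rotation carries the ray of phase \<open>\<theta>\<close> to the positive reals, so
  the sign of the imaginary part tells on which side of that ray the charge lies, without choosing a
  branch of the argument.\<close>

lemma semistable_Im:
  assumes "E \<in> P \<phi>" "E \<in> nonzero_obs D"
  obtains r where "r > 0" "\<And>\<theta>. Im (W E * cis (- (pi * \<theta>))) = r * sin (pi * (\<phi> - \<theta>))"
proof -
  obtain r where r: "r > 0" "W E = of_real r * cis (pi * \<phi>)" using W_semistable[OF assms] by blast
  have "W E * cis (- (pi * \<theta>)) = of_real r * cis (pi * (\<phi> - \<theta>))" for \<theta>
    by (simp add: r(2) mult.assoc cis_mult right_diff_distrib)
  then show thesis using that[OF r(1)] by simp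
qed

lemma HN_Im:
  assumes HN: "HN_data D P E n \<phi> Es A"
  obtains r where "\<And>k. k \<in> {1..n} \<Longrightarrow> r k > 0"
    "\<And>\<theta>. Im (W E * cis (- (pi * \<theta>))) = (\<Sum>k=1..n. r k * sin (pi * (\<phi> k - \<theta>)))"
proof -
  have "\<exists>r>0. \<forall>\<theta>. Im (W (A k) * cis (- (pi * \<theta>))) = r * sin (pi * (\<phi> k - \<theta>))" if "k \<in> {1..n}" for k
    using semistable_Im HN_factor[OF HN that] by metis
  then obtain r where r: "\<And>k. k \<in> {1..n} \<Longrightarrow> r k > 0"
    "\<And>k \<theta>. k \<in> {1..n} \<Longrightarrow> Im (W (A k) * cis (- (pi * \<theta>))) = r k * sin (pi * (\<phi> k - \<theta>))"
    by metis
  have "Im (W E * cis (- (pi * \<theta>))) = (\<Sum>k=1..n. r k * sin (pi * (\<phi> k - \<theta>)))" for \<theta>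
    unfolding W_HN[OF HN] sum_distrib_right Im_sum using r(2) by (intro sum.cong) auto
  then show thesis using that[of r] r(1) by blast
qed

text \<open>All factors have phases strictly within a half turn after \<open>\<theta>\<close>, so
  every sine is positive. Used contrapositively, to bound a phase by a sign of the charge.\<close>

lemma Im_pos_if_phases_above:
  assumes E: "E \<in> nonzero_obs D" and "\<theta> < phi_minus D P E" "phi_plus D P E < \<theta> + 1"
  shows "0 < Im (W E * cis (- (pi * \<theta>)))"
proof -
  obtain n \<phi> Es A where HN: "HN_data D P E n \<phi> Es A" "1 \<le> n"
      "phi_plus D P E = \<phi> 1" "phi_minus D P E = \<phi> n"
    by (rule HN_exists[OF E])
  obtain r where r: "\<And>k. k \<in> {1..n} \<Longrightarrow> r k > 0"
    "\<And>\<theta>. Im (W E * cis (- (pi * \<theta>))) = (\<Sum>k=1..n. r k * sin (pi * (\<phi> k - \<theta>)))"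
    using HN_Im[OF HN(1)] by blast
  have "0 < r k * sin (pi * (\<phi> k - \<theta>))" if "k \<in> {1..n}" for k
    using r(1)[OF that] HN_phase_bounds[OF HN(1) that] HN(3,4) assms(2,3)
    by (intro mult_pos_pos sin_gt_zero) auto
  then show ?thesis unfolding r(2) using HN(2) by (intro sum_pos) auto
qed

lemma Im_neg_if_phases_below:
  assumes E: "E \<in> nonzero_obs D" and "\<theta> - 1 < phi_minus D P E" "phi_plus D P E < \<theta>"
  shows "Im (W E * cis (- (pi * \<theta>))) < 0"
proof -
  have "cis (- (pi * (\<theta> - 1))) = - cis (- (pi * \<theta>))"
    by (simp add: right_diff_distrib cis.ctr complex_eq_iff sin_diff cos_diff)
  then show ?thesis using Im_pos_if_phases_above[OF E, of "\<theta> - 1"] assms(2,3) by simp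
qed

text \<open>In the closed window no sine is negative, so a vanishing sum makes each sine vanish,
  which happens at the two ends only.\<close>

lemma phases_if_Im_zero:
  assumes E: "E \<in> nonzero_obs D" and "\<theta> \<le> phi_minus D P E" "phi_plus D P E \<le> \<theta> + 1"
    and "Im (W E * cis (- (pi * \<theta>))) = 0"
  shows "phi_plus D P E \<in> {\<theta>, \<theta> + 1}" "phi_minus D P E \<in> {\<theta>, \<theta> + 1}"
proof -
  obtain n \<phi> Es A where HN: "HN_data D P E n \<phi> Es A" "1 \<le> n"
      "phi_plus D P E = \<phi> 1" "phi_minus D P E = \<phi> n"
    by (rule HN_exists[OF E])
  obtain r where r: "\<And>k. k \<in> {1..n} \<Longrightarrow> r k > 0"
    "\<And>\<theta>. Im (W E * cis (- (pi * \<theta>))) = (\<Sum>k=1..n. r k * sin (pi * (\<phi> k - \<theta>)))"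
    using HN_Im[OF HN(1)] by blast
  have bd: "\<theta> \<le> \<phi> k" "\<phi> k \<le> \<theta> + 1" if "k \<in> {1..n}" for k
    using HN_phase_bounds[OF HN(1) that] HN(3,4) assms(2,3) by auto
  have "0 \<le> r k * sin (pi * (\<phi> k - \<theta>))" if "k \<in> {1..n}" for k
    using r(1)[OF that] bd[OF that] by (intro mult_nonneg_nonneg sin_ge_zero) auto
  then have "r k * sin (pi * (\<phi> k - \<theta>)) = 0" if "k \<in> {1..n}" for k
    using sum_nonneg_eq_0_iff[of "{1..n}" "\<lambda>k. r k * sin (pi * (\<phi> k - \<theta>))"] assms(4) r(2)[of \<theta>] that
    by simp
  moreover have "0 < r k * sin (pi * (\<phi> k - \<theta>))" if "k \<in> {1..n}" "\<phi> k \<notin> {\<theta>, \<theta> + 1}" for k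
    using r(1)[OF that(1)] bd[OF that(1)] that(2) by (intro mult_pos_pos sin_gt_zero) (auto simp: less_le)
  ultimately have "\<phi> k \<in> {\<theta>, \<theta> + 1}" if "k \<in> {1..n}" for k using that by fastforce
  then show "phi_plus D P E \<in> {\<theta>, \<theta> + 1}" "phi_minus D P E \<in> {\<theta>, \<theta> + 1}"
    using HN(2,3,4) by auto
qed

text \<open>Since \<open>W C\<close> lies on the line through \<open>cis (pi * \<phi>)\<close> while the phases of \<open>C\<close> are
  in \<open>[\<phi>, \<phi> + 1]\<close>, only the phases \<open>\<phi>\<close> and \<open>\<phi> + 1\<close> can occur; the monomorphism
  excludes the latter.\<close>

lemma cone_of_mono_semistable:
  assumes A: "A \<in> P \<phi>" "A \<in> nonzero_obs D" and E: "E \<in> P \<phi>" "E \<in> nonzero_obs D"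
    and mono: "mono_in D (P \<phi>) A E i" and t: "triangle D A E C i p q" and C: "C \<in> nonzero_obs D"
  shows "C \<in> P \<phi>"
proof -
  obtain T where T: "T \<in> P (phi_plus D P C)" "\<not> hom_zero D T C"
    by (rule phi_plus_attained[OF C])
  obtain S where S: "S \<in> P (phi_minus D P C)" "\<not> hom_zero D C S"
    by (rule phi_minus_attained[OF C])
  \<comment> \<open>In the rotated triangle \<open>C\<close> lies between \<open>E\<close>, of phase
    \<open>\<phi>\<close>, and \<open>shO D A\<close>, of phase \<open>\<phi> + 1\<close>; objects
    of larger phase have no maps to either, and dually for \<open>minus\<close>.\<close>
  have plus: "phi_plus D P C \<le> \<phi> + 1"
    using hom_zero_cone_to[OF t] slice_hom_zero[OF T(1) E(1)] slice_hom_zero[OF T(1) slice_shift[OF A(1)]] T(2)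
    by (smt (verit))
  have minus: "\<phi> \<le> phi_minus D P C"
    using hom_zero_cone_from[OF t] slice_hom_zero[OF E(1) S(1)] slice_hom_zero[OF slice_shift[OF A(1)] S(1)] S(2)
    by (smt (verit))
  obtain r s where r: "\<And>\<theta>. Im (W A * cis (- (pi * \<theta>))) = r * sin (pi * (\<phi> - \<theta>))"
    and s: "\<And>\<theta>. Im (W E * cis (- (pi * \<theta>))) = s * sin (pi * (\<phi> - \<theta>))"
    using semistable_Im[OF A] semistable_Im[OF E] by metis
  have "W C = W E - W A" using W_triangle[OF t] by simp
  then have "Im (W C * cis (- (pi * \<phi>))) = 0"
    using r[of \<phi>] s[of \<phi>] by (simp only: left_diff_distrib minus_complex.sel) simp
  then have phases: "phi_plus D P C \<in> {\<phi>, \<phi> + 1}" "phi_minus D P C \<in> {\<phi>, \<phi> + 1}"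
    using phases_if_Im_zero[OF C minus plus] by blast+
  have "phi_plus D P C \<noteq> \<phi> + 1"
  proof
    assume eq: "phi_plus D P C = \<phi> + 1"
    obtain B where B: "B \<in> P \<phi>" "isomorphic D T (shO D B)"
      using slice_unshift[OF T(1)] eq by auto
    have "hom_zero D (shO D B) E"
      using slice_hom_zero[OF slice_shift[OF B(1)] E(1)] by simp
    then have "hom_zero D (shO D B) C"
      using mono_shift_hom_zero[OF mono t B(1) slice_Ob[OF B(1)]] by blast
    then show False using hom_zero_iso_left[OF isomorphic_sym[OF B(2)]] T(2) by blast
  qed
  then show ?thesis
    using semistable_if_phases_const[OF C] phases phi_minus_le_phi_plus[OF C] by force
qed

text \<open>Induction on \<open>\<bar>W E\<bar>\<close>, which is additive on short exact sequences in \<open>P \<phi>\<close>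
  and takes only finitely many values below a given bound.\<close>

lemma semistable_nonneg_if_stable_nonneg:
  fixes L :: "'o \<Rightarrow> real"
  assumes L: "\<And>X Y C f g h. triangle D X Y C f g h \<Longrightarrow> L Y = L X + L C"
    and stable: "\<And>F. sigma_stable D P \<phi> F \<Longrightarrow> 0 \<le> L F"
    and discrete: "\<And>M. \<exists>\<delta>>0. \<forall>F. F \<in> P \<phi> \<longrightarrow> F \<in> nonzero_obs D \<longrightarrow> cmod (W F) \<le> M \<longrightarrow> \<delta> \<le> cmod (W F)"
    and E: "E \<in> P \<phi>" "E \<in> nonzero_obs D"
  shows "0 \<le> L E"
proof -
  obtain \<delta> where \<delta>: "\<delta> > 0"
    "\<And>F. \<lbrakk>F \<in> P \<phi>; F \<in> nonzero_obs D; cmod (W F) \<le> cmod (W E)\<rbrakk> \<Longrightarrow> \<delta> \<le> cmod (W F)"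
    using discrete[of "cmod (W E)"] by blast
  have "\<lbrakk>F \<in> P \<phi>; F \<in> nonzero_obs D; cmod (W F) \<le> cmod (W E); cmod (W F) < real n * \<delta>\<rbrakk> \<Longrightarrow> 0 \<le> L F" for n F
  proof (induction n arbitrary: F)
    case 0
    then show ?case using norm_ge_zero[of "W F"] by simp
  next
    case (Suc n)
    show ?case
    proof (cases "sigma_stable D P \<phi> F")
      case True
      then show ?thesis by (rule stable)
    next
      case False
      then obtain A i where A: "A \<in> P \<phi>" "mono_in D (P \<phi>) A F i" "\<not> zero_ob D A" "\<not> iso_mor D A F i"
        using Suc.prems by (auto simp: sigma_stable_def simple_in_def nonzero_obs_def)
      then have A': "A \<in> nonzero_obs D" using slice_Ob by (simp add: nonzero_obs_def)
      obtain C p q where t: "triangle D A F C i p q"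
        using triangle_exists[of i A F] A(2) by (auto simp: mono_in_def)
      have C': "C \<in> nonzero_obs D"
        using triangle_zero_cone_iso[OF t] A(4) triangle_Ob[OF t] by (auto simp: nonzero_obs_def)
      have C: "C \<in> P \<phi>"
        using cone_of_mono_semistable[OF A(1) A' Suc.prems(1,2) A(2) t C'] .
      obtain r s where r: "r > 0" "W A = of_real r * cis (pi * \<phi>)"
        and s: "s > 0" "W C = of_real s * cis (pi * \<phi>)"
        using W_semistable[OF A(1) A'] W_semistable[OF C C'] by blast
      \<comment> \<open>Both charges lie on the same ray, so the absolute values add
        exactly.\<close>
      have "W F = of_real (r + s) * cis (pi * \<phi>)"
        using W_triangle[OF t] r s by (simp add: distrib_right)
      then have norm: "cmod (W F) = cmod (W A) + cmod (W C)"
        using r s by (simp add: norm_mult del: of_real_add)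
      have le: "cmod (W A) \<le> cmod (W E)" "cmod (W C) \<le> cmod (W E)"
        using norm Suc.prems(3) norm_ge_zero[of "W A"] norm_ge_zero[of "W C"] by linarith+
      have "\<delta> \<le> cmod (W A)" "\<delta> \<le> cmod (W C)" using \<delta>(2) A(1) A' C C' le by blast+
      \<comment> \<open>Each part has size at least \<open>\<delta>\<close>, so the other one is
        smaller than \<open>F\<close> by at least \<open>\<delta>\<close>.\<close>
      then have "cmod (W A) < real n * \<delta>" "cmod (W C) < real n * \<delta>"
        using norm Suc.prems(4) by (simp_all add: distrib_right)
      then have "0 \<le> L A" "0 \<le> L C" using Suc.IH A(1) A' C C' le by blast+
      then show ?thesis using L[OF t] by simp
    qed
  qed
  moreover obtain n where "cmod (W E) < real n * \<delta>" using \<delta>(1) reals_Archimedean3 by blast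
  ultimately show ?thesis using E by blast
qed

end

section \<open>Monotonicity of the phases\<close>

text \<open>The points where \<open>f\<close> lies above the line of slope
  \<open>- \<epsilon>\<close> through its value at \<open>x\<close> form a compact set. The local
  bound at its largest element would reach further, so that element is \<open>y\<close>; then
  \<open>\<epsilon>\<close> tends to 0.\<close>

lemma mono_on_if_right_Dini_nonneg:
  fixes f :: "real \<Rightarrow> real"
  assumes cont: "continuous_on {a..b} f"
    and right: "\<And>t \<epsilon>. \<lbrakk>a \<le> t; t < b; \<epsilon> > 0\<rbrakk> \<Longrightarrow>
      \<exists>d>0. \<forall>s. t < s \<longrightarrow> s < t + d \<longrightarrow> s \<le> b \<longrightarrow> f t - \<epsilon> * (s - t) \<le> f s"
  shows "mono_on {a..b} f"
proof (rule mono_onI)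
  fix x y assume xy: "x \<in> {a..b}" "y \<in> {a..b}" "x \<le> y"
  have bound: "f x - \<epsilon> * (y - x) \<le> f y" if \<epsilon>: "\<epsilon> > 0" for \<epsilon>
  proof -
    define S where "S = {s \<in> {x..y}. f x - \<epsilon> * (s - x) \<le> f s}"
    have "closed S"
      unfolding S_def using xy
      by (intro continuous_on_closed_Collect_le continuous_intros continuous_on_subset[OF cont]) auto
    moreover have "bounded S" unfolding S_def by (rule bounded_subset[of "{x..y}"]) auto
    ultimately have "compact S" by (simp add: compact_eq_bounded_closed)
    moreover have "x \<in> S" using xy by (simp add: S_def)
    ultimately obtain c where c: "c \<in> S" "\<forall>s\<in>S. s \<le> c" using compact_attains_sup[of S] by blast
    have "c = y"
    proof (rule ccontr)
      assume "c \<noteq> y"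
      with c(1) have cy: "x \<le> c" "c < y" by (auto simp: S_def)
      obtain d where d: "d > 0" "\<forall>s. c < s \<longrightarrow> s < c + d \<longrightarrow> s \<le> b \<longrightarrow> f c - \<epsilon> * (s - c) \<le> f s"
        using right[of c \<epsilon>] cy xy \<epsilon> by auto
      define s where "s = min (c + d / 2) y"
      have s: "c < s" "s < c + d" "s \<le> y" using d(1) cy by (auto simp: s_def min_def)
      then have "f c - \<epsilon> * (s - c) \<le> f s" using d(2) xy by auto
      moreover have "f x - \<epsilon> * (c - x) \<le> f c" using c(1) by (simp add: S_def)
      ultimately have "s \<in> S" using s cy by (simp add: S_def algebra_simps)
      then show False using c(2) s(1) by force
    qed
    then show ?thesis using c(1) by (simp add: S_def)
  qed
  show "f x \<le> f y"
  proof (rule field_le_epsilon)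
    fix e :: real assume e: "e > 0"
    \<comment> \<open>The added 1 keeps the denominator positive when \<open>x = y\<close>.\<close>
    have "e / (y - x + 1) * (y - x) \<le> e"
      using e xy(3) by (simp add: divide_le_eq)
    then show "f x \<le> f y + e" using bound[of "e / (y - x + 1)"] e xy(3) by simp
  qed
qed

text \<open>The point reflection of the graph exchanges left and right and preserves
  monotonicity.\<close>

lemma mono_on_if_left_Dini_nonneg:
  fixes f :: "real \<Rightarrow> real"
  assumes cont: "continuous_on {a..b} f"
    and left: "\<And>t \<epsilon>. \<lbrakk>a < t; t \<le> b; \<epsilon> > 0\<rbrakk> \<Longrightarrow>
      \<exists>d>0. \<forall>s. t - d < s \<longrightarrow> s < t \<longrightarrow> a \<le> s \<longrightarrow> f s \<le> f t + \<epsilon> * (t - s)"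
  shows "mono_on {a..b} f"
proof -
  have mono: "mono_on {-b..-a} (\<lambda>t. - f (- t))"
  proof (rule mono_on_if_right_Dini_nonneg)
    show "continuous_on {-b..-a} (\<lambda>t. - f (- t))"
      by (intro continuous_intros continuous_on_compose2[OF cont]) auto
    fix t \<epsilon> :: real assume "-b \<le> t" "t < -a" "\<epsilon> > 0"
    then obtain d where "d > 0"
      and d: "\<And>s. - t - d < s \<Longrightarrow> s < - t \<Longrightarrow> a \<le> s \<Longrightarrow> f s \<le> f (- t) + \<epsilon> * (- t - s)"
      using left[of "- t" \<epsilon>] by auto
    have "- f (- t) - \<epsilon> * (s - t) \<le> - f (- s)" if "t < s" "s < t + d" "s \<le> -a" for s
      using d[of "- s"] that by (simp add: algebra_simps)
    then show "\<exists>d>0. \<forall>s. t < s \<longrightarrow> s < t + d \<longrightarrow> s \<le> -a \<longrightarrow> - f (- t) - \<epsilon> * (s - t) \<le> - f (- s)"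
      using \<open>d > 0\<close> by blast
  qed
  show ?thesis
  proof (rule mono_onI)
    fix x y assume "x \<in> {a..b}" "y \<in> {a..b}" "x \<le> y"
    then show "f x \<le> f y" using mono_onD[OF mono, of "- y" "- x"] by simp
  qed
qed

text \<open>The phase \<open>\<phi> - \<epsilon> * (t - t0)\<close> rotates backwards, so that the charge \<open>w\<close>, whose
  argument is nondecreasing to first order at \<open>t0\<close>, moves strictly ahead of it.\<close>

lemma charge_crosses_rotating_ray:
  fixes w :: "real \<Rightarrow> complex"
  assumes w: "(w has_vector_derivative w') (at t0 within S)"
    and w0: "w t0 = of_real r * cis (pi * \<phi>)" and r: "r > 0" and \<epsilon>: "\<epsilon> > 0"
    and nonneg: "0 \<le> Im (w' * cnj (w t0))"
  obtains d where "d > 0"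
    "\<And>t. \<lbrakk>t \<in> S; t0 < t; t < t0 + d\<rbrakk> \<Longrightarrow> 0 < Im (w t * cis (- (pi * (\<phi> - \<epsilon> * (t - t0)))))"
    "\<And>t. \<lbrakk>t \<in> S; t0 - d < t; t < t0\<rbrakk> \<Longrightarrow> Im (w t * cis (- (pi * (\<phi> - \<epsilon> * (t - t0))))) < 0"
proof -
  define g where "g t = Im (w t) * cos (pi * (\<phi> - \<epsilon> * (t - t0))) - Re (w t) * sin (pi * (\<phi> - \<epsilon> * (t - t0)))" for t
  have g: "Im (w t * cis (- (pi * (\<phi> - \<epsilon> * (t - t0))))) = g t" for t
    by (simp add: g_def)
  have ReIm: "((\<lambda>t. Re (w t)) has_real_derivative Re w') (at t0 within S)"
    "((\<lambda>t. Im (w t)) has_real_derivative Im w') (at t0 within S)"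
    unfolding has_real_derivative_iff_has_vector_derivative
    using bounded_linear.has_vector_derivative[OF bounded_linear_Re w]
      bounded_linear.has_vector_derivative[OF bounded_linear_Im w] by auto
  \<comment> \<open>The first two terms are the imaginary part of \<open>w'\<close> rotated by
    \<open>cis (- (pi * \<phi>))\<close>, nonnegative by hypothesis. The term with
    \<open>\<epsilon>\<close> comes from the moving ray and equals
    \<open>pi * \<epsilon> * r\<close>, which makes \<open>l\<close> strictly positive.\<close>
  define l where "l = Im w' * cos (pi * \<phi>) - Re w' * sin (pi * \<phi>)
    + pi * \<epsilon> * (Im (w t0) * sin (pi * \<phi>) + Re (w t0) * cos (pi * \<phi>))"
  have deriv: "(g has_real_derivative l) (at t0 within S)"
    unfolding g_def l_def
    by (rule derivative_eq_intros ReIm refl | simp)+ (simp add: algebra_simps)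
  have "Im (w' * cnj (w t0)) = r * (Im w' * cos (pi * \<phi>) - Re w' * sin (pi * \<phi>))"
    by (simp add: w0 algebra_simps)
  then have "0 \<le> Im w' * cos (pi * \<phi>) - Re w' * sin (pi * \<phi>)"
    using nonneg r by (simp add: zero_le_mult_iff)
  moreover have "Im (w t0) * sin (pi * \<phi>) + Re (w t0) * cos (pi * \<phi>) = r"
  proof -
    have "Im (w t0) * sin (pi * \<phi>) + Re (w t0) * cos (pi * \<phi>)
        = r * (cos (pi * \<phi>) * cos (pi * \<phi>) + sin (pi * \<phi>) * sin (pi * \<phi>))"
      unfolding distrib_left by (simp add: w0)
    then show ?thesis by (simp only: sin_cos_squared_add3)
  qed
  ultimately have "l > 0" using r \<epsilon> by (simp add: l_def add_nonneg_pos)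
  moreover have "g t0 = 0" by (simp add: g_def w0)
  ultimately obtain d1 d2 where d: "d1 > 0" "d2 > 0"
    "\<And>h. \<lbrakk>h > 0; t0 + h \<in> S; h < d1\<rbrakk> \<Longrightarrow> 0 < g (t0 + h)"
    "\<And>h. \<lbrakk>h > 0; t0 - h \<in> S; h < d2\<rbrakk> \<Longrightarrow> g (t0 - h) < 0"
    using has_real_derivative_pos_inc_right[OF deriv] has_real_derivative_pos_inc_left[OF deriv] by metis
  show thesis
  proof (rule that[of "min d1 d2"])
    show "min d1 d2 > 0" using d by simp
    show "0 < Im (w t * cis (- (pi * (\<phi> - \<epsilon> * (t - t0)))))" if "t \<in> S" "t0 < t" "t < t0 + min d1 d2" for t
      using d(3)[of "t - t0"] that unfolding g by simp
    show "Im (w t * cis (- (pi * (\<phi> - \<epsilon> * (t - t0))))) < 0" if "t \<in> S" "t0 - min d1 d2 < t" "t < t0" for t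
      using d(4)[of "t0 - t"] that unfolding g by simp
  qed
qed

text \<open>The sign condition is imposed on semistable objects, because the estimates follow
  Harder--Narasimhan factors; the passage from stable objects is made when the locale is
  instantiated.\<close>

locale charged_slicing_family =
  fixes D :: "('o, 'm, 'z) tri_data_scheme" and P :: "real \<Rightarrow> real \<Rightarrow> 'o set"
    and W W' :: "real \<Rightarrow> 'o \<Rightarrow> complex"
  assumes charged: "t \<in> {0..1} \<Longrightarrow> charged_slicing D (P t) (W t)"
    and near: "\<lbrakk>t \<in> {0..1}; \<epsilon> > 0\<rbrakk> \<Longrightarrow> \<exists>d>0. \<forall>s \<in> {0..1}. \<bar>s - t\<bar> < d \<longrightarrow> (\<forall>F \<in> nonzero_obs D.
      \<bar>phi_plus D (P t) F - phi_plus D (P s) F\<bar> < \<epsilon> \<and> \<bar>phi_minus D (P t) F - phi_minus D (P s) F\<bar> < \<epsilon>)"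
    and deriv: "\<lbrakk>t \<in> {0..1}; E \<in> nonzero_obs D\<rbrakk> \<Longrightarrow>
      ((\<lambda>s. W s E) has_vector_derivative W' t E) (at t within {0..1})"
    and semistable_nonneg: "\<lbrakk>t \<in> {0..1}; E \<in> P t \<phi>; E \<in> nonzero_obs D\<rbrakk> \<Longrightarrow>
      0 \<le> Im (W' t E * cnj (W t E))"
begin

lemma phi_continuous:
  assumes "E \<in> nonzero_obs D"
  shows "continuous_on {0..1} (\<lambda>t. phi_plus D (P t) E)" "continuous_on {0..1} (\<lambda>t. phi_minus D (P t) E)"
  unfolding continuous_on_iff dist_real_def
  using near assms by (metis abs_minus_commute)+

lemma semistable_charge_crosses:
  assumes t0: "t0 \<in> {0..1}" and F: "F \<in> P t0 \<phi>" "F \<in> nonzero_obs D" and \<epsilon>: "\<epsilon> > 0"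
  obtains d where "d > 0"
    "\<And>t. \<lbrakk>t \<in> {0..1}; t0 < t; t < t0 + d\<rbrakk> \<Longrightarrow> 0 < Im (W t F * cis (- (pi * (\<phi> - \<epsilon> * (t - t0)))))"
    "\<And>t. \<lbrakk>t \<in> {0..1}; t0 - d < t; t < t0\<rbrakk> \<Longrightarrow> Im (W t F * cis (- (pi * (\<phi> - \<epsilon> * (t - t0))))) < 0"
proof -
  obtain r where r: "r > 0" "W t0 F = of_real r * cis (pi * \<phi>)"
    using charged_slicing.W_semistable[OF charged[OF t0] F] by blast
  show thesis
    by (rule charge_crosses_rotating_ray[OF deriv[OF t0 F(2)] r(2,1) \<epsilon> semistable_nonneg[OF t0 F]])
      (rule that)
qed

lemma phi_plus_right_Dini_nonneg:
  assumes E: "E \<in> nonzero_obs D" and t0: "0 \<le> t0" "t0 < 1" and \<epsilon>: "\<epsilon> > 0"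
  shows "\<exists>d>0. \<forall>t. t0 < t \<longrightarrow> t < t0 + d \<longrightarrow> t \<le> 1 \<longrightarrow>
    phi_plus D (P t0) E - \<epsilon> * (t - t0) \<le> phi_plus D (P t) E"
proof -
  have t0': "t0 \<in> {0..1}" using t0 by simp
  interpret P0: charged_slicing D "P t0" "W t0" by (rule charged[OF t0'])
  obtain n \<phi> Es A where HN: "HN_data D (P t0) E n \<phi> Es A" and n: "1 \<le> n"
    and plus: "phi_plus D (P t0) E = \<phi> 1"
    by (rule P0.HN_exists[OF E])
  have F: "A 1 \<in> P t0 (\<phi> 1)" "A 1 \<in> nonzero_obs D" using P0.HN_factor[OF HN, of 1] n by auto
  obtain d1 where d1: "d1 > 0" "\<And>t. \<lbrakk>t \<in> {0..1}; t0 < t; t < t0 + d1\<rbrakk> \<Longrightarrow>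
      0 < Im (W t (A 1) * cis (- (pi * (\<phi> 1 - \<epsilon> * (t - t0)))))"
    by (rule semistable_charge_crosses[OF t0' F \<epsilon>]) (rule that)
  \<comment> \<open>\<open>1/2\<close> serves twice: as the tolerance in
    \<open>phi_plus_first_factor_le\<close>, and to keep the phases of \<open>A 1\<close> in a
    window of length 1 in which the sign of the charge is determined.\<close>
  obtain d2 where d2: "d2 > 0" "\<And>t G. \<lbrakk>t \<in> {0..1}; \<bar>t - t0\<bar> < d2; G \<in> nonzero_obs D\<rbrakk> \<Longrightarrow>
      \<bar>phi_plus D (P t0) G - phi_plus D (P t) G\<bar> < 1/2 \<and> \<bar>phi_minus D (P t0) G - phi_minus D (P t) G\<bar> < 1/2"
    using near[OF t0', of "1/2"] by auto
  have "phi_plus D (P t0) E - \<epsilon> * (t - t0) \<le> phi_plus D (P t) E"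
    if t: "t0 < t" "t < t0 + min d1 d2" "t \<le> 1" for t
  proof -
    have t': "t \<in> {0..1}" "\<bar>t - t0\<bar> < d2" using t t0 by auto
    interpret Pt: charged_slicing D "P t" "W t" by (rule charged[OF t'(1)])
    \<comment> \<open>Otherwise all phases of \<open>A 1\<close> at \<open>t\<close> would lie less
      than a half turn behind the moving ray, and its charge too, against the choice of
      \<open>d1\<close>.\<close>
    have "\<phi> 1 - \<epsilon> * (t - t0) \<le> phi_plus D (P t) (A 1)"
    proof (rule ccontr)
      assume "\<not> ?thesis"
      moreover have "\<phi> 1 - \<epsilon> * (t - t0) - 1 < phi_minus D (P t) (A 1)"
        using d2(2)[OF t' F(2), THEN conjunct2] P0.semistable_phases(2)[OF F] t(1) \<epsilon>
          mult_pos_pos[of \<epsilon> "t - t0"] by linarith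
      ultimately have "Im (W t (A 1) * cis (- (pi * (\<phi> 1 - \<epsilon> * (t - t0))))) < 0"
        by (intro Pt.Im_neg_if_phases_below[OF F(2)]) auto
      then show False using d1(2)[OF t'(1)] t by force
    qed
    also have "\<dots> \<le> phi_plus D (P t) E"
      using d2(2)[OF t']
      by (intro phi_plus_first_factor_le[OF P0.sliced_category_axioms Pt.sliced_category_axioms E _ HN n]) blast
    finally show ?thesis using plus by simp
  qed
  then show ?thesis using d1(1) d2(1) by (intro exI[of _ "min d1 d2"]) auto
qed

lemma phi_minus_left_Dini_nonneg:
  assumes E: "E \<in> nonzero_obs D" and t0: "0 < t0" "t0 \<le> 1" and \<epsilon>: "\<epsilon> > 0"
  shows "\<exists>d>0. \<forall>t. t0 - d < t \<longrightarrow> t < t0 \<longrightarrow> 0 \<le> t \<longrightarrow>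
    phi_minus D (P t) E \<le> phi_minus D (P t0) E + \<epsilon> * (t0 - t)"
proof -
  have t0': "t0 \<in> {0..1}" using t0 by simp
  interpret P0: charged_slicing D "P t0" "W t0" by (rule charged[OF t0'])
  obtain n \<phi> Es A where HN: "HN_data D (P t0) E n \<phi> Es A" and n: "1 \<le> n"
    and minus: "phi_minus D (P t0) E = \<phi> n"
    by (rule P0.HN_exists[OF E])
  have F: "A n \<in> P t0 (\<phi> n)" "A n \<in> nonzero_obs D" using P0.HN_factor[OF HN, of n] n by auto
  obtain d1 where d1: "d1 > 0" "\<And>t. \<lbrakk>t \<in> {0..1}; t0 - d1 < t; t < t0\<rbrakk> \<Longrightarrow>
      Im (W t (A n) * cis (- (pi * (\<phi> n - \<epsilon> * (t - t0))))) < 0"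
    by (rule semistable_charge_crosses[OF t0' F \<epsilon>]) (rule that)
  obtain d2 where d2: "d2 > 0" "\<And>t G. \<lbrakk>t \<in> {0..1}; \<bar>t - t0\<bar> < d2; G \<in> nonzero_obs D\<rbrakk> \<Longrightarrow>
      \<bar>phi_plus D (P t0) G - phi_plus D (P t) G\<bar> < 1/2 \<and> \<bar>phi_minus D (P t0) G - phi_minus D (P t) G\<bar> < 1/2"
    using near[OF t0', of "1/2"] by auto
  have "phi_minus D (P t) E \<le> phi_minus D (P t0) E + \<epsilon> * (t0 - t)"
    if t: "t0 - min d1 d2 < t" "t < t0" "0 \<le> t" for t
  proof -
    have t': "t \<in> {0..1}" "\<bar>t - t0\<bar> < d2" using t t0 by auto
    interpret Pt: charged_slicing D "P t" "W t" by (rule charged[OF t'(1)])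
    have "phi_minus D (P t) E \<le> phi_minus D (P t) (A n)"
      using d2(2)[OF t']
      by (intro phi_minus_last_factor_ge[OF P0.sliced_category_axioms Pt.sliced_category_axioms E _ HN n]) blast
    \<comment> \<open>Before \<open>t0\<close> the moving ray is ahead of \<open>\<phi> n\<close>
      and the charge of \<open>A n\<close> lies behind it; phases all above the ray, within a half
      turn, would put the charge ahead.\<close>
    also have "\<dots> \<le> \<phi> n - \<epsilon> * (t - t0)"
    proof (rule ccontr)
      assume "\<not> ?thesis"
      moreover have "phi_plus D (P t) (A n) < \<phi> n - \<epsilon> * (t - t0) + 1"
        using d2(2)[OF t' F(2), THEN conjunct1] P0.semistable_phases(1)[OF F] t(2) \<epsilon>
          mult_pos_neg[of \<epsilon> "t - t0"] by linarith
      ultimately have "0 < Im (W t (A n) * cis (- (pi * (\<phi> n - \<epsilon> * (t - t0)))))"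
        by (intro Pt.Im_pos_if_phases_above[OF F(2)]) auto
      then show False using d1(2)[OF t'(1)] t by force
    qed
    finally show ?thesis using minus by (simp add: algebra_simps)
  qed
  then show ?thesis using d1(1) d2(1) by (intro exI[of _ "min d1 d2"]) auto
qed

lemma phi_mono:
  assumes E: "E \<in> nonzero_obs D"
  shows "mono_on {0..1} (\<lambda>t. phi_minus D (P t) E)" "mono_on {0..1} (\<lambda>t. phi_plus D (P t) E)"
  using mono_on_if_left_Dini_nonneg[OF phi_continuous(2)[OF E] phi_minus_left_Dini_nonneg[OF E]]
    mono_on_if_right_Dini_nonneg[OF phi_continuous(1)[OF E] phi_plus_right_Dini_nonneg[OF E]] by blast+

end

section \<open>From stability conditions to families of charged slicings\<close>

lemma slicing_dist_less:
  assumes "slicing_dist D P Q < ennreal \<epsilon>" and "F \<in> nonzero_obs D"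
  shows "\<bar>phi_plus D P F - phi_plus D Q F\<bar> < \<epsilon>" "\<bar>phi_minus D P F - phi_minus D Q F\<bar> < \<epsilon>"
proof -
  have "max (ennreal \<bar>phi_plus D P F - phi_plus D Q F\<bar>) (ennreal \<bar>phi_minus D P F - phi_minus D Q F\<bar>)
      \<le> slicing_dist D P Q"
    unfolding slicing_dist_def using assms(2) by (rule SUP_upper)
  then have "max (ennreal \<bar>phi_plus D P F - phi_plus D Q F\<bar>) (ennreal \<bar>phi_minus D P F - phi_minus D Q F\<bar>)
      < ennreal \<epsilon>"
    using assms(1) by (rule order_le_less_trans)
  then show "\<bar>phi_plus D P F - phi_plus D Q F\<bar> < \<epsilon>" "\<bar>phi_minus D P F - phi_minus D Q F\<bar> < \<epsilon>"
    by (simp_all add: ennreal_less_iff)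
qed

lemma continuous_family_near:
  fixes M :: "'x::metric_space set"
  assumes "continuous_family D \<Gamma> \<iota> cl M Z P" and "t \<in> M" "\<epsilon> > 0"
  shows "\<exists>d>0. \<forall>s \<in> M. dist s t < d \<longrightarrow> (\<forall>F \<in> nonzero_obs D.
    \<bar>phi_plus D (P t) F - phi_plus D (P s) F\<bar> < \<epsilon> \<and> \<bar>phi_minus D (P t) F - phi_minus D (P s) F\<bar> < \<epsilon>)"
proof -
  obtain U where U: "openin (top_of_set M) U" "t \<in> U"
    "\<forall>y \<in> U. slicing_dist D (P t) (P y) < ennreal \<epsilon>"
    using assms unfolding continuous_family_def by meson
  obtain d where d: "d > 0" "ball t d \<inter> M \<subseteq> U"
    using U(1,2) unfolding openin_contains_ball by blast
  have close: "slicing_dist D (P t) (P s) < ennreal \<epsilon>" if "s \<in> M" "dist s t < d" for s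
  proof -
    have "s \<in> U" using d(2) that by (auto simp: dist_commute)
    then show ?thesis using U(3) by blast
  qed
  show ?thesis
    by (intro exI[of _ d] conjI ballI impI d(1) slicing_dist_less[OF close])
qed

text \<open>By the support property a bound on the charge bounds the class, so only finitely many
  lattice points, hence finitely many nonzero values, can occur.\<close>

lemma stability_condition_discrete:
  assumes \<Gamma>: "realification \<Gamma> \<iota>" and cl: "cl \<in> hom (K_group D) \<Gamma>"
    and stab: "stability_condition D \<Gamma> \<iota> cl Z P"
  shows "\<exists>\<delta>>0. \<forall>F. F \<in> P \<phi> \<longrightarrow> F \<in> nonzero_obs D \<longrightarrow>
    cmod (Z (cl (K_class D F))) \<le> M \<longrightarrow> \<delta> \<le> cmod (Z (cl (K_class D F)))"
proof -
  obtain \<epsilon> where \<epsilon>: "\<epsilon> > 0" "\<And>\<phi> F. F \<in> P \<phi> \<Longrightarrow> F \<in> nonzero_obs D \<Longrightarrow>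
      \<epsilon> * norm (\<iota> (cl (K_class D F))) \<le> cmod (Z (cl (K_class D F)))"
    using stab unfolding stability_condition_def sigma_semistable_def by blast
  define V where "V = (\<lambda>\<gamma>. cmod (Z \<gamma>)) ` {\<gamma> \<in> carrier \<Gamma>. norm (\<iota> \<gamma>) \<le> M / \<epsilon>} - {0}"
  have fin: "finite V" unfolding V_def using finite_lattice_ball[OF \<Gamma>] by simp
  \<comment> \<open>The inserted 1 covers the case that \<open>V\<close> is empty.\<close>
  define \<delta> where "\<delta> = Min (insert 1 V)"
  have "\<delta> > 0" unfolding \<delta>_def using fin by (auto simp: V_def)
  moreover have "\<delta> \<le> cmod (Z (cl (K_class D F)))"
    if F: "F \<in> P \<phi>" "F \<in> nonzero_obs D" and M: "cmod (Z (cl (K_class D F))) \<le> M" for F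
  proof -
    have "cl (K_class D F) \<in> carrier \<Gamma>"
      using hom_in_carrier[OF cl K_class_carrier] F(2) by (simp add: nonzero_obs_def)
    moreover have "norm (\<iota> (cl (K_class D F))) \<le> M / \<epsilon>"
      using \<epsilon>(2)[OF F] M \<epsilon>(1) by (simp add: le_divide_eq mult.commute)
    moreover obtain r where "r > 0"
      "Z (cl (K_class D F)) = complex_of_real r * exp (\<i> * complex_of_real (pi * \<phi>))"
      using stab F unfolding stability_condition_def sigma_semistable_def by blast
    then have "cmod (Z (cl (K_class D F))) \<noteq> 0" by simp
    ultimately have "cmod (Z (cl (K_class D F))) \<in> V" unfolding V_def by blast
    then show ?thesis unfolding \<delta>_def using fin by simp
  qed
  ultimately show ?thesis by blast
qed

lemma (in triangulated_category) charged_slicing_stability_condition: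
  assumes cl: "cl \<in> hom (K_group D) \<Gamma>" and stab: "stability_condition D \<Gamma> \<iota> cl Z P"
  shows "charged_slicing D P (\<lambda>E. Z (cl (K_class D E)))"
proof unfold_locales
  have Z: "Z \<in> hom \<Gamma> additive_group" and P: "slicing D P"
    using stab unfolding stability_condition_def by blast+
  show "slicing D P" by (rule P)
  show "Z (cl (K_class D Y)) = Z (cl (K_class D X)) + Z (cl (K_class D C))"
    if "triangle D X Y C f g h" for X Y C f g h
    using charge_triangle[OF cl Z that] .
  show "\<exists>r>0. Z (cl (K_class D E)) = of_real r * cis (pi * \<phi>)"
    if "E \<in> P \<phi>" "E \<in> nonzero_obs D" for E \<phi>
    using stab that unfolding stability_condition_def sigma_semistable_def cis_conv_exp by blast
qed

theorem theorem3p12: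
  fixes D :: "('o, 'm, 'z) tri_data_scheme"
    and \<Gamma> :: "('g, 'w) monoid_scheme"
    and \<iota> :: "'g \<Rightarrow> 'v::real_normed_vector"
    and cl :: "('o \<Rightarrow>\<^sub>0 int) set \<Rightarrow> 'g"
    and Z Z' :: "real \<Rightarrow> 'g \<Rightarrow> complex"
    and P :: "real \<Rightarrow> real \<Rightarrow> 'o set"
  assumes "triangulated_category D"
    and "free_of_finite_rank \<Gamma>"
    and "realification \<Gamma> \<iota>"
    and "cl \<in> hom (K_group D) \<Gamma>"
    and "continuous_family D \<Gamma> \<iota> cl {0..1} Z P"
    and "has_derivative_family \<Gamma> {0..1} Z Z'"
    and "\<And>t \<phi> E. \<lbrakk>t \<in> {0..1}; sigma_stable D (P t) \<phi> E\<rbrakk> \<Longrightarrow>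
           Im (Z' t (cl (K_class D E)) * cnj (Z t (cl (K_class D E)))) \<ge> 0"
  shows "\<forall>E \<in> nonzero_obs D.
           mono_on {0..1} (\<lambda>t. phi_minus D (P t) E) \<and>
           mono_on {0..1} (\<lambda>t. phi_plus D (P t) E)"
proof -
  interpret triangulated_category D by fact
  note cl = assms(4)
  define W where "W t E = Z t (cl (K_class D E))" for t E
  define W' where "W' t E = Z' t (cl (K_class D E))" for t E
  have stab: "stability_condition D \<Gamma> \<iota> cl (Z t) (P t)" if "t \<in> {0..1}" for t
    using assms(5) that unfolding continuous_family_def by blast
  have charged: "charged_slicing D (P t) (W t)" if "t \<in> {0..1}" for t
    unfolding W_def using charged_slicing_stability_condition[OF cl stab[OF that]] .
  have deriv: "((\<lambda>s. W s E) has_vector_derivative W' t E) (at t within {0..1})"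
    if "t \<in> {0..1}" "E \<in> Ob D" for t E
    using assms(6) that hom_in_carrier[OF cl K_class_carrier]
    unfolding has_derivative_family_def W_def W'_def by blast
  \<comment> \<open>\<open>Z' t\<close> is not given as a homomorphism; additivity comes from that
    of \<open>W\<close> by uniqueness of derivatives, also at the endpoints, which are limit points
    of the interval.\<close>
  have W'_triangle: "W' t Y = W' t X + W' t C" if t: "t \<in> {0..1}" and tri: "triangle D X Y C f g h"
    for t X Y C f g h
  proof (rule vector_derivative_unique_within)
    show "at t within {0..1} \<noteq> bot"
      using t by (simp add: trivial_limit_within islimpt_Icc)
    have Ob: "X \<in> Ob D" "Y \<in> Ob D" "C \<in> Ob D" using triangle_Ob[OF tri] by auto
    show "((\<lambda>s. W s Y) has_vector_derivative W' t Y) (at t within {0..1})" by (rule deriv[OF t Ob(2)])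
    show "((\<lambda>s. W s Y) has_vector_derivative W' t X + W' t C) (at t within {0..1})"
    proof (rule has_vector_derivative_transform[OF t])
      show "((\<lambda>s. W s X + W s C) has_vector_derivative W' t X + W' t C) (at t within {0..1})"
        by (intro has_vector_derivative_add deriv t Ob)
      show "W s Y = W s X + W s C" if "s \<in> {0..1}" for s
        using charged_slicing.W_triangle[OF charged[OF that] tri] .
    qed
  qed
  have nonneg: "0 \<le> Im (W' t E * cnj (W t E))"
    if t: "t \<in> {0..1}" and E: "E \<in> P t \<phi>" "E \<in> nonzero_obs D" for t E \<phi>
  proof -
    interpret Pt: charged_slicing D "P t" "W t" by (rule charged[OF t])
    \<comment> \<open>The sign condition is quadratic in the class of \<open>F\<close>. At fixed
      phase \<open>W t F\<close> is a positive multiple of \<open>cis (pi * \<phi>)\<close>, so it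
      becomes the sign of an expression additive on triangles.\<close>
    have rotate: "0 \<le> Im (W' t F * cnj (W t F)) \<longleftrightarrow> 0 \<le> Im (W' t F * cis (- (pi * \<phi>)))"
      if F: "F \<in> P t \<phi>" "F \<in> nonzero_obs D" for F
    proof -
      obtain r where r: "r > 0" "W t F = of_real r * cis (pi * \<phi>)" using Pt.W_semistable[OF F] by blast
      have "Im (W' t F * cnj (W t F)) = r * Im (W' t F * cis (- (pi * \<phi>)))"
        by (simp add: r(2) algebra_simps)
      then show ?thesis
        using mult_le_cancel_left_pos[OF r(1), of 0] by (simp only: mult_zero_right)
    qed
    have "0 \<le> Im (W' t E * cis (- (pi * \<phi>)))"
    proof (rule Pt.semistable_nonneg_if_stable_nonneg[OF _ _ _ E])
      show "Im (W' t Y * cis (- (pi * \<phi>))) = Im (W' t X * cis (- (pi * \<phi>))) + Im (W' t C * cis (- (pi * \<phi>)))"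
        if "triangle D X Y C f g h" for X Y C f g h
        unfolding W'_triangle[OF t that] by (simp add: algebra_simps)
      show "0 \<le> Im (W' t F * cis (- (pi * \<phi>)))" if F: "sigma_stable D (P t) \<phi> F" for F
      proof -
        have "F \<in> P t \<phi>" "F \<in> nonzero_obs D"
          using F Pt.slice_Ob by (auto simp: sigma_stable_def simple_in_def nonzero_obs_def)
        from rotate[OF this] show ?thesis
          using assms(7)[OF t F] by (simp only: W_def W'_def)
      qed
      show "\<exists>\<delta>>0. \<forall>F. F \<in> P t \<phi> \<longrightarrow> F \<in> nonzero_obs D \<longrightarrow> cmod (W t F) \<le> M \<longrightarrow> \<delta> \<le> cmod (W t F)" for M
        unfolding W_def by (rule stability_condition_discrete[OF assms(3) cl stab[OF t]])
    qed
    then show ?thesis using rotate[OF E] by blast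
  qed
  interpret charged_slicing_family D P W W'
  proof (rule charged_slicing_family.intro)
    show "\<exists>d>0. \<forall>s \<in> {0..1}. \<bar>s - t\<bar> < d \<longrightarrow> (\<forall>F \<in> nonzero_obs D.
        \<bar>phi_plus D (P t) F - phi_plus D (P s) F\<bar> < \<epsilon> \<and> \<bar>phi_minus D (P t) F - phi_minus D (P s) F\<bar> < \<epsilon>)"
      if "t \<in> {0..1}" "\<epsilon> > 0" for t \<epsilon>
      using continuous_family_near[OF assms(5) that] by (simp add: dist_real_def)
    show "((\<lambda>s. W s E) has_vector_derivative W' t E) (at t within {0..1})"
      if "t \<in> {0..1}" "E \<in> nonzero_obs D" for t E
      using deriv that by (simp add: nonzero_obs_def)
  qed (fact charged nonneg)+
  show ?thesis using phi_mono by blast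
qed

end
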